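(* Consider a run of the IDDP algorithm (described in the context). Let Assumptions (H1) and (H2) (stated in the context) hold and assume that the noises are bounded: for $t=1,\ldots,T$, $0\le\varepsilon_t^k\le\bar\varepsilon_t<+\infty$ for all $k\ge1$. Set $\bar\delta_1=0$ and, for $t=2,\ldots,T$, $\bar\delta_t=\bar\eta_t$ if $X_t$ is of type S1 and $\bar\delta_t=\bar\eta_t+\bar\varepsilon_t$ if $X_t$ is of type S2, where $\bar\eta_t$ is the upper bound on $(\eta_t^k(\varepsilon_t^k))_{k\ge1}$ given in the context. Let $\bar\varepsilon=\max_{t=1,\ldots,T}\bar\varepsilon_t$ and $\bar\delta=\max_{t=2,\ldots,T}\bar\delta_t$. Then for $t=2,\ldots,T$ and $k\ge 1$ the distance $\underline{\mathcal{Q}}_t^k(x_{t-1}^k)-\mathcal{C}_t^k(x_{t-1}^k)$ is at most $\bar\delta_t\le\bar\delta$, and any accumulation point of the sequence $(x_1^k,\ldots,x_T^k)_{k\ge1}$ is a $\frac{T(T+1)}{2}(\bar\delta+\bar\varepsilon)$-optimal solution of problem (P) of the context (i.e. it is feasible and its objective value is at most $\mathcal{Q}_1(x_0)+\frac{T(T+1)}{2}(\bar\delta+\bar\varepsilon)$).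
   Context: **Notation.** $\mathbb{B}_n(x_0,r)$ is the closed Euclidean ball; $\mathrm{ri}$ is relative interior; $\mathrm{Aff}$ is affine span; $X^{\varepsilon}=X+\varepsilon\mathbb{B}_n(0,1)$; $\mathrm{Diam}(X)=\max_{x,y\in X}\|x-y\|$; $\mathcal{C}^1(\mathcal{X})$ is the set of real-valued continuously differentiable functions on $\mathcal{X}$. **Problem.** Given $x_0\in\mathbb{R}^n$, consider $$(P)\qquad \inf_{x_1,\ldots,x_T}\ \sum_{t=1}^T f_t(x_t,x_{t-1}),\qquad x_t\in X_t(x_{t-1}),\ t=1,\ldots,T,$$ with dynamic programming equations $\mathcal{Q}_{T+1}\equiv0$ and, for $t=1,\ldots,T$, $\mathcal{Q}_t(x_{t-1})=\inf\{f_t(x_t,x_{t-1})+\mathcal{Q}_{t+1}(x_t)\,:\,x_t\in X_t(x_{t-1})\}$; $\mathcal{Q}_1(x_0)$ is the optimal value of (P). For each $t$, $X_t$ is of one of two types (the type may depend on $t$): type S1: $X_t(x_{t-1})=\mathcal{X}_t\subset\mathbb{R}^n$; type S2: $X_t(x_{t-1})=\{x_t\in\mathcal{X}_t: g_t(x_t,x_{t-1})\le0,\ A_tx_t+B_tx_{t-1}=b_t\}$, where $g_t$ has $p$ components $g_{ti}$ and $A_t,B_t$ have $q$ rows. Set $\mathcal{X}_0=\{x_0\}$. **Assumption (H1).** For $t=1,\ldots,T$: (a) $\mathcal{X}_t$ is nonempty, convex, compact; (b) $f_t$ is convex on $\mathcal{X}_t\times\mathcal{X}_{t-1}$ and belongs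 to $\mathcal{C}^1(\mathcal{X}_t\times\mathcal{X}_{t-1})$. There is $\varepsilon>0$ such that for every $t$ with $X_t$ of type S2: (c) each $g_{ti}$ is convex on $\mathcal{X}_t\times\mathcal{X}_{t-1}^{\varepsilon}$ and belongs to $\mathcal{C}^1(\mathcal{X}_t\times\mathcal{X}_{t-1})$; (d) for every $x_{t-1}\in\mathcal{X}_{t-1}^{\varepsilon}$ the set $X_t(x_{t-1})\cap\mathrm{ri}(\mathcal{X}_t)$ is nonempty; (e) if $t\ge2$ there is $(\bar x_{tt},\bar x_{t\,t-1})\in\mathrm{ri}(\mathcal{X}_t)\times\mathcal{X}_{t-1}$ with $A_t\bar x_{tt}+B_t\bar x_{t\,t-1}=b_t$ and $g_t(\bar x_{tt},\bar x_{t\,t-1})<0$. **Assumption (H2).** For $t=2,\ldots,T$ (with $X_t$ of type S2) there are $\kappa_t>0,r_t>0$ such that for every $x_{t-1}\in\mathcal{X}_{t-1}$ there is $x_t\in\mathcal{X}_t$ with $\mathbb{B}_n(x_t,r_t)\cap\mathrm{Aff}(\mathcal{X}_t)\subseteq\mathcal{X}_t$, $A_tx_t+B_tx_{t-1}=b_t$, and $g_{ti}(x_t,x_{t-1})\le-\kappa_t$ for $i=1,\ldots,p$. **IDDP algorithm.** Let $\varepsilon_t^k\ge0$ be given noises. Put $\mathcal{Q}_t^0\equiv-\infty$ for $t=2,\ldots,T$ and $\mathcal{Q}_{T+1}^k\equiv0$ for all $k\ge 0$. Let $F_t^k(y,x)=f_t(y,x)+\mathcal{Q}_{t+1}^k(y)$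 and $\underline{\mathcal{Q}}_t^k(x)=\inf\{F_t^k(y,x):y\in X_t(x)\}$. An $\varepsilon$-optimal solution is a feasible point whose objective value is within $\varepsilon$ of the optimal value (when the objective is identically $-\infty$, any feasible point). Iteration $k\ge1$: *Forward pass*: $x_0^k=x_0$; for $t=1,\ldots,T$, $x_t^k$ is an $\varepsilon_t^k$-optimal solution of $\inf\{F_t^{k-1}(y,x_{t-1}^k):y\in X_t(x_{t-1}^k)\}$. *Backward pass*: for $t=T,\ldots,2$, let $x_t^{Bk}$ be an $\varepsilon_t^k$-optimal solution of $\inf\{F_t^k(y,x_{t-1}^k):y\in X_t(x_{t-1}^k)\}$. If $X_t$ is of type S1: $\theta_t^k=f_t(x_t^{Bk},x_{t-1}^k)+\mathcal{Q}_{t+1}^k(x_t^{Bk})$, $\beta_t^k=\nabla_{x_{t-1}}f_t(x_t^{Bk},x_{t-1}^k)$, and $$\eta_t^k(\varepsilon_t^k)=\max_{x_t\in\mathcal{X}_t}\ \langle\nabla_{x_t}f_t(x_t^{Bk},x_{t-1}^k),x_t^{Bk}-x_t\rangle+\mathcal{Q}_{t+1}^k(x_t^{Bk})-\mathcal{Q}_{t+1}^k(x_t).$$ If $X_t$ is of type S2: let $(\lambda_t^k,\mu_t^k)$ be an $\varepsilon_t^k$-optimal solution of the dual problem of maximizing $h(\lambda,\mu)=\inf_{y\in\mathcal{X}_t}\{F_t^k(y,x_{t-1}^k)+\lambda^T(A_ty+B_tx_{t-1}^k-b_t)+\mu^Tg_t(y,x_{t-1}^k)\}$ over $\mu\in\mathbb{R}_+^p$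 and $\lambda\in\{A_ty+B_tx_{t-1}^k-b_t:y\in\mathrm{Aff}(\mathcal{X}_t)\}$; then $\theta_t^k=f_t(x_t^{Bk},x_{t-1}^k)+\mathcal{Q}_{t+1}^k(x_t^{Bk})+\langle\mu_t^k,g_t(x_t^{Bk},x_{t-1}^k)\rangle$, $\beta_t^k=\nabla_{x_{t-1}}f_t(x_t^{Bk},x_{t-1}^k)+B_t^T\lambda_t^k+\sum_{i=1}^p\mu_t^k(i)\nabla_{x_{t-1}}g_{ti}(x_t^{Bk},x_{t-1}^k)$, and $$\eta_t^k(\varepsilon_t^k)=\max_{x_t\in\mathcal{X}_t}\Big\langle\nabla_{x_t}f_t(x_t^{Bk},x_{t-1}^k)+A_t^T\lambda_t^k+\sum_{i=1}^p\mu_t^k(i)\nabla_{x_t}g_{ti}(x_t^{Bk},x_{t-1}^k),\,x_t^{Bk}-x_t\Big\rangle+\mathcal{Q}_{t+1}^k(x_t^{Bk})-\mathcal{Q}_{t+1}^k(x_t).$$ In both cases define the cut $\mathcal{C}_t^k(x_{t-1})=\theta_t^k-\eta_t^k(\varepsilon_t^k)+\langle\beta_t^k,x_{t-1}-x_{t-1}^k\rangle$ and $\mathcal{Q}_t^k=\max_{1\le j\le k}\mathcal{C}_t^j$. **The constants $\bar\eta_t$.** Let $M_{t2},M_{t3}$ be finite constants with $\|\nabla f_t\|\le M_{t2}$ and $\|\nabla g_{ti}\|\le M_{t3}$ ($i=1,\ldots,p$) on $\mathcal{X}_t\times\mathcal{X}_{t-1}$, $L(f_t)$ a Lipschitz constant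 of $f_t$ on $\mathcal{X}_t\times\mathcal{X}_{t-1}$, and $L(\mathcal{Q}_{t+1})$ a Lipschitz constant of $\mathcal{Q}_{t+1}$ on $\mathcal{X}_t$. Put $L_{T+1}=0$. For $t=T,\ldots,2$: if $X_t$ is of type S1, $\bar\eta_t=(M_{t2}+L_{t+1})\,\mathrm{Diam}(\mathcal{X}_t)$ and $L_t=M_{t2}$. If $X_t$ is of type S2, with $V_{\mathcal{X}_t}=\{x-y:x,y\in\mathrm{Aff}(\mathcal{X}_t)\}$, with $r_t$ decreased if necessary so that $r_t\le\kappa_t/(2L(g_t))$ where $L(g_t)>0$ is a common Lipschitz constant of the $g_{ti}$ on $\mathcal{X}_t\times\mathcal{X}_{t-1}$, and with $\rho_t>0$ such that $\mathbb{B}_q(0,\rho_t)\cap A_tV_{\mathcal{X}_t}\subseteq A_t(\mathbb{B}_n(0,r_t)\cap V_{\mathcal{X}_t})$, let $$U_t=\frac{(L(f_t)+L(\mathcal{Q}_{t+1}))r_t+\bar\varepsilon_t+\max_{x_t\in\mathcal{X}_t,x_{t-1}\in\mathcal{X}_{t-1}}(f_t(x_t,x_{t-1})+\mathcal{Q}_{t+1}(x_t))-\min_{x_{t-1}\in\mathcal{X}_{t-1}}\underline{\mathcal{Q}}_t^1(x_{t-1})}{\min(\rho_t,\kappa_t/2)},$$ $\bar\eta_t=\big(M_{t2}+\sqrt2\max(\|A_t^T\|,M_{t3}\sqrt p)\,U_t+L_{t+1}\big)\mathrm{Diam}(\mathcal{X}_t)$ and $L_t=M_{t2}+\sqrt2\max(\|B_t^T\|,M_{t3}\sqrt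 p)\,U_t$. *)

theory Defs
  imports "HOL-Analysis.Analysis"
begin

section \<open>Gradients and continuously differentiable functions\<close>

definition grad :: "('a::real_inner \<Rightarrow> real) \<Rightarrow> 'a \<Rightarrow> 'a" where
  "grad F z = (THE D. GDERIV F z :> D)"

definition grad1 :: "('a::real_inner \<times> 'b::real_inner \<Rightarrow> real) \<Rightarrow> 'a \<times> 'b \<Rightarrow> 'a" where
  "grad1 F z = grad (\<lambda>u. F (u, snd z)) (fst z)"

definition grad2 :: "('a::real_inner \<times> 'b::real_inner \<Rightarrow> real) \<Rightarrow> 'a \<times> 'b \<Rightarrow> 'b" where
  "grad2 F z = grad (\<lambda>v. F (fst z, v)) (snd z)"

text \<open>The set \<open>S\<close> need not be open. Differentiability at the points of \<open>S\<close> is meant in the ambient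
  space, so that the gradient is unique even where \<open>S\<close> has empty interior; continuity of the
  gradient is only required on \<open>S\<close>. Any function that is continuously differentiable on an open
  neighbourhood of \<open>S\<close> qualifies.\<close>

definition C1_on :: "'a::euclidean_space set \<Rightarrow> ('a \<Rightarrow> real) \<Rightarrow> bool" where
  "C1_on S F \<longleftrightarrow> (\<forall>z\<in>S. F differentiable (at z)) \<and> continuous_on S (grad F)"


section \<open>The multistage problem\<close>

datatype stage_type = S1 | S2

text \<open>Functions of two stages take the pair \<open>(x\<^sub>t, x\<^sub>t\<^sub>-\<^sub>1)\<close>, current decision first. The fields
  \<open>ineq\<close>, \<open>matA\<close>, \<open>matB\<close>, \<open>rhs\<close> are only used at stages of type \<open>S2\<close>.\<close>

record ('n, 'p, 'q) problem =
  horizon :: nat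
  x_init :: "real^'n::finite"
  cset :: "nat \<Rightarrow> (real^'n) set"
  stype :: "nat \<Rightarrow> stage_type"
  cost :: "nat \<Rightarrow> (real^'n) \<times> (real^'n) \<Rightarrow> real"
  ineq :: "nat \<Rightarrow> (real^'n) \<times> (real^'n) \<Rightarrow> real^'p::finite"
  matA :: "nat \<Rightarrow> real^'n^'q::finite"
  matB :: "nat \<Rightarrow> real^'n^'q"
  rhs :: "nat \<Rightarrow> real^'q"

definition XX :: "('n::finite, 'p::finite, 'q::finite) problem \<Rightarrow> nat \<Rightarrow> (real^'n) set" where
  "XX P t = (if t = 0 then {x_init P} else cset P t)"

definition eq_resid ::
  "('n::finite, 'p::finite, 'q::finite) problem \<Rightarrow> nat \<Rightarrow> real^'n \<Rightarrow> real^'n \<Rightarrow> real^'q" where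
  "eq_resid P t y x = matA P t *v y + matB P t *v x - rhs P t"

definition feas ::
  "('n::finite, 'p::finite, 'q::finite) problem \<Rightarrow> nat \<Rightarrow> real^'n \<Rightarrow> (real^'n) set" where
  "feas P t x =
    (case stype P t of
       S1 \<Rightarrow> XX P t
     | S2 \<Rightarrow> {y \<in> XX P t. (\<forall>i. ineq P t (y, x) $ i \<le> 0) \<and> eq_resid P t y x = 0})"

text \<open>Value functions: \<open>valfun P t\<close> is \<open>\<Q>\<^sub>t\<close>. Extended reals give the value \<open>\<infinity>\<close> to an infeasible
  problem.\<close>

function valfun ::
  "('n::finite, 'p::finite, 'q::finite) problem \<Rightarrow> nat \<Rightarrow> real^'n \<Rightarrow> ereal" where
  "valfun P t x =
    (if horizon P < t then 0
     else (INF y\<in>feas P t x. ereal (cost P t (y, x)) + valfun P (Suc t) y))"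
  by pat_completeness auto
termination
  by (relation "Wellfounded.measure (\<lambda>(P, t, x). Suc (horizon P) - t)") auto

declare valfun.simps [simp del]

text \<open>A trajectory is a function \<open>z\<close> of which only \<open>z 1, \<dots>, z T\<close> matter; \<open>with_init\<close> prepends
  the given initial state.\<close>

definition with_init ::
  "('n::finite, 'p::finite, 'q::finite) problem \<Rightarrow> (nat \<Rightarrow> real^'n) \<Rightarrow> nat \<Rightarrow> real^'n" where
  "with_init P z = z(0 := x_init P)"

definition feasible_traj ::
  "('n::finite, 'p::finite, 'q::finite) problem \<Rightarrow> (nat \<Rightarrow> real^'n) \<Rightarrow> bool" where
  "feasible_traj P z \<longleftrightarrow>
    (\<forall>t\<in>{1..horizon P}. with_init P z t \<in> feas P t (with_init P z (t - 1)))"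

definition total_cost ::
  "('n::finite, 'p::finite, 'q::finite) problem \<Rightarrow> (nat \<Rightarrow> real^'n) \<Rightarrow> real" where
  "total_cost P z =
    (\<Sum>t=1..horizon P. cost P t (with_init P z t, with_init P z (t - 1)))"

definition eps_optimal_traj ::
  "('n::finite, 'p::finite, 'q::finite) problem \<Rightarrow> real \<Rightarrow> (nat \<Rightarrow> real^'n) \<Rightarrow> bool" where
  "eps_optimal_traj P e z \<longleftrightarrow>
    feasible_traj P z \<and> ereal (total_cost P z) \<le> valfun P 1 (x_init P) + ereal e"


section \<open>Assumptions\<close>

definition enlarge :: "real \<Rightarrow> 'a::real_normed_vector set \<Rightarrow> 'a set" where
  "enlarge e X = {x + e *\<^sub>R u |x u. x \<in> X \<and> u \<in> cball 0 1}"

definition H1 :: "('n::finite, 'p::finite, 'q::finite) problem \<Rightarrow> bool" where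
  "H1 P \<longleftrightarrow>
    (\<forall>t\<in>{1..horizon P}.
       XX P t \<noteq> {} \<and> convex (XX P t) \<and> compact (XX P t) \<and>
       convex_on (XX P t \<times> XX P (t - 1)) (cost P t) \<and>
       C1_on (XX P t \<times> XX P (t - 1)) (cost P t)) \<and>
    (\<exists>e>0. \<forall>t\<in>{1..horizon P}. stype P t = S2 \<longrightarrow>
       (\<forall>i. convex_on (XX P t \<times> enlarge e (XX P (t - 1))) (\<lambda>z. ineq P t z $ i) \<and>
            C1_on (XX P t \<times> XX P (t - 1)) (\<lambda>z. ineq P t z $ i)) \<and>
       (\<forall>x\<in>enlarge e (XX P (t - 1)). feas P t x \<inter> rel_interior (XX P t) \<noteq> {}) \<and>
       (2 \<le> t \<longrightarrow>
          (\<exists>y\<in>rel_interior (XX P t). \<exists>x\<in>XX P (t - 1).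
             eq_resid P t y x = 0 \<and> (\<forall>i. ineq P t (y, x) $ i < 0))))"

text \<open>The witnesses \<open>\<kappa>\<close> and \<open>r\<close> of the uniform Slater condition are arguments, because the error
  bounds below are expressed through them.\<close>

definition H2 ::
  "('n::finite, 'p::finite, 'q::finite) problem \<Rightarrow> (nat \<Rightarrow> real) \<Rightarrow> (nat \<Rightarrow> real) \<Rightarrow> bool" where
  "H2 P \<kappa> r \<longleftrightarrow>
    (\<forall>t\<in>{2..horizon P}. stype P t = S2 \<longrightarrow>
       0 < \<kappa> t \<and> 0 < r t \<and>
       (\<forall>x\<in>XX P (t - 1). \<exists>y\<in>XX P t.
          cball y (r t) \<inter> affine hull (XX P t) \<subseteq> XX P t \<and>
          eq_resid P t y x = 0 \<and> (\<forall>i. ineq P t (y, x) $ i \<le> - \<kappa> t)))"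


section \<open>The IDDP algorithm\<close>

text \<open>In the extended reals, every point of \<open>S\<close> satisfies \<open>eps_min\<close> when \<open>F\<close> is identically
  \<open>-\<infinity>\<close> on \<open>S\<close>.\<close>

definition eps_min :: "real \<Rightarrow> ('a \<Rightarrow> ereal) \<Rightarrow> 'a set \<Rightarrow> 'a \<Rightarrow> bool" where
  "eps_min e F S y \<longleftrightarrow> y \<in> S \<and> F y \<le> (INF z\<in>S. F z) + ereal e"

definition eps_max :: "real \<Rightarrow> ('a \<Rightarrow> ereal) \<Rightarrow> 'a set \<Rightarrow> 'a \<Rightarrow> bool" where
  "eps_max e F S y \<longleftrightarrow> y \<in> S \<and> (SUP z\<in>S. F z) \<le> F y + ereal e"

text \<open>Everything an execution produces, indexed by stage \<open>t\<close> and then iteration \<open>k\<close>: the forward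
  points \<open>x\<^sub>t\<^sup>k\<close>, the backward points \<open>x\<^sub>t\<^sup>B\<^sup>k\<close>, the dual solutions, and the cuts \<open>\<C>\<^sub>t\<^sup>k\<close>.\<close>

record ('n, 'p, 'q) execution =
  fwd :: "nat \<Rightarrow> nat \<Rightarrow> real^'n::finite"
  bwd :: "nat \<Rightarrow> nat \<Rightarrow> real^'n"
  lam :: "nat \<Rightarrow> nat \<Rightarrow> real^'q::finite"
  mu :: "nat \<Rightarrow> nat \<Rightarrow> real^'p::finite"
  cutfun :: "nat \<Rightarrow> nat \<Rightarrow> real^'n \<Rightarrow> real"

text \<open>\<open>approx P R t k\<close> is \<open>\<Q>\<^sub>t\<^sup>k\<close>, \<open>stage_obj P R t k\<close> is \<open>F\<^sub>t\<^sup>k\<close> and \<open>underval P R t k\<close> is the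
  approximation of \<open>\<Q>\<^sub>t\<close> obtained by minimizing \<open>F\<^sub>t\<^sup>k\<close>.\<close>

definition approx ::
  "('n::finite, 'p::finite, 'q::finite) problem \<Rightarrow> ('n, 'p, 'q) execution \<Rightarrow>
    nat \<Rightarrow> nat \<Rightarrow> real^'n \<Rightarrow> ereal" where
  "approx P R t k x =
    (if horizon P < t then 0 else if k = 0 then - \<infinity> else ereal (MAX j\<in>{1..k}. cutfun R t j x))"

definition stage_obj ::
  "('n::finite, 'p::finite, 'q::finite) problem \<Rightarrow> ('n, 'p, 'q) execution \<Rightarrow>
    nat \<Rightarrow> nat \<Rightarrow> real^'n \<Rightarrow> real^'n \<Rightarrow> ereal" where
  "stage_obj P R t k y x = ereal (cost P t (y, x)) + approx P R (Suc t) k y"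

definition underval ::
  "('n::finite, 'p::finite, 'q::finite) problem \<Rightarrow> ('n, 'p, 'q) execution \<Rightarrow>
    nat \<Rightarrow> nat \<Rightarrow> real^'n \<Rightarrow> ereal" where
  "underval P R t k x = (INF y\<in>feas P t x. stage_obj P R t k y x)"

definition dual_fun ::
  "('n::finite, 'p::finite, 'q::finite) problem \<Rightarrow> ('n, 'p, 'q) execution \<Rightarrow>
    nat \<Rightarrow> nat \<Rightarrow> real^'n \<Rightarrow> (real^'q) \<times> (real^'p) \<Rightarrow> ereal" where
  "dual_fun P R t k x = (\<lambda>(l, m).
    INF y\<in>XX P t. stage_obj P R t k y x + ereal (l \<bullet> eq_resid P t y x + m \<bullet> ineq P t (y, x)))"

definition dual_dom ::
  "('n::finite, 'p::finite, 'q::finite) problem \<Rightarrow> nat \<Rightarrow> real^'n \<Rightarrow>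
    ((real^'q) \<times> (real^'p)) set" where
  "dual_dom P t x =
    {(l, m). l \<in> (\<lambda>y. eq_resid P t y x) ` (affine hull (XX P t)) \<and> (\<forall>i. 0 \<le> m $ i)}"

definition trial ::
  "('n::finite, 'p::finite, 'q::finite) execution \<Rightarrow> nat \<Rightarrow> nat \<Rightarrow> (real^'n) \<times> (real^'n)" where
  "trial R t k = (bwd R t k, fwd R (t - 1) k)"

text \<open>In the next four definitions \<open>k \<ge> 1\<close>, where \<open>approx P R (Suc t) k\<close> is finite.\<close>

definition cut_theta ::
  "('n::finite, 'p::finite, 'q::finite) problem \<Rightarrow> ('n, 'p, 'q) execution \<Rightarrow>
    nat \<Rightarrow> nat \<Rightarrow> real" where
  "cut_theta P R t k =
    cost P t (trial R t k) + real_of_ereal (approx P R (Suc t) k (bwd R t k)) +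
    (case stype P t of S1 \<Rightarrow> 0 | S2 \<Rightarrow> mu R t k \<bullet> ineq P t (trial R t k))"

definition cut_beta ::
  "('n::finite, 'p::finite, 'q::finite) problem \<Rightarrow> ('n, 'p, 'q) execution \<Rightarrow>
    nat \<Rightarrow> nat \<Rightarrow> real^'n" where
  "cut_beta P R t k =
    grad2 (cost P t) (trial R t k) +
    (case stype P t of
       S1 \<Rightarrow> 0
     | S2 \<Rightarrow> transpose (matB P t) *v lam R t k +
            (\<Sum>i\<in>UNIV. mu R t k $ i *\<^sub>R grad2 (\<lambda>z. ineq P t z $ i) (trial R t k)))"

definition decision_slope ::
  "('n::finite, 'p::finite, 'q::finite) problem \<Rightarrow> ('n, 'p, 'q) execution \<Rightarrow>
    nat \<Rightarrow> nat \<Rightarrow> real^'n" where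
  "decision_slope P R t k =
    grad1 (cost P t) (trial R t k) +
    (case stype P t of
       S1 \<Rightarrow> 0
     | S2 \<Rightarrow> transpose (matA P t) *v lam R t k +
            (\<Sum>i\<in>UNIV. mu R t k $ i *\<^sub>R grad1 (\<lambda>z. ineq P t z $ i) (trial R t k)))"

definition cut_eta ::
  "('n::finite, 'p::finite, 'q::finite) problem \<Rightarrow> ('n, 'p, 'q) execution \<Rightarrow>
    nat \<Rightarrow> nat \<Rightarrow> real" where
  "cut_eta P R t k =
    (SUP y\<in>XX P t. decision_slope P R t k \<bullet> (bwd R t k - y) +
       real_of_ereal (approx P R (Suc t) k (bwd R t k)) -
       real_of_ereal (approx P R (Suc t) k y))"

definition iddp_run ::
  "('n::finite, 'p::finite, 'q::finite) problem \<Rightarrow> (nat \<Rightarrow> nat \<Rightarrow> real) \<Rightarrow>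
    ('n, 'p, 'q) execution \<Rightarrow> bool" where
  "iddp_run P \<epsilon> R \<longleftrightarrow>
    (\<forall>k\<ge>1.
       fwd R 0 k = x_init P \<and>
       (\<forall>t\<in>{1..horizon P}.
          eps_min (\<epsilon> t k) (\<lambda>y. stage_obj P R t (k - 1) y (fwd R (t - 1) k))
            (feas P t (fwd R (t - 1) k)) (fwd R t k)) \<and>
       (\<forall>t\<in>{2..horizon P}.
          eps_min (\<epsilon> t k) (\<lambda>y. stage_obj P R t k y (fwd R (t - 1) k))
            (feas P t (fwd R (t - 1) k)) (bwd R t k) \<and>
          (stype P t = S2 \<longrightarrow>
             eps_max (\<epsilon> t k) (dual_fun P R t k (fwd R (t - 1) k))
               (dual_dom P t (fwd R (t - 1) k)) (lam R t k, mu R t k)) \<and>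
          cutfun R t k =
            (\<lambda>x. cut_theta P R t k - cut_eta P R t k + cut_beta P R t k \<bullet> (x - fwd R (t - 1) k))))"


section \<open>Error bounds\<close>

text \<open>\<open>Lipf t\<close>, \<open>Lipg t\<close> are Lipschitz constants of \<open>f\<^sub>t\<close>, \<open>g\<^sub>t\<^sub>i\<close>, and \<open>LipQ t\<close> is one of \<open>\<Q>\<^sub>t\<close>
  on \<open>\<X>\<^sub>t\<^sub>-\<^sub>1\<close>; \<open>kap\<close> and \<open>rad\<close> are the witnesses of \<open>H2\<close>.\<close>

record bounds =
  M2 :: "nat \<Rightarrow> real"
  M3 :: "nat \<Rightarrow> real"
  Lipf :: "nat \<Rightarrow> real"
  Lipg :: "nat \<Rightarrow> real"
  LipQ :: "nat \<Rightarrow> real"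
  kap :: "nat \<Rightarrow> real"
  rad :: "nat \<Rightarrow> real"
  rho :: "nat \<Rightarrow> real"

definition dir_space :: "'a::real_vector set \<Rightarrow> 'a set" where
  "dir_space X = {x - y |x y. x \<in> affine hull X \<and> y \<in> affine hull X}"

definition valid_bounds ::
  "('n::finite, 'p::finite, 'q::finite) problem \<Rightarrow> bounds \<Rightarrow> bool" where
  "valid_bounds P K \<longleftrightarrow>
    (\<forall>t\<in>{2..horizon P}.
       (\<forall>z\<in>XX P t \<times> XX P (t - 1). norm (grad (cost P t) z) \<le> M2 K t) \<and>
       (stype P t = S2 \<longrightarrow>
          (\<forall>i. \<forall>z\<in>XX P t \<times> XX P (t - 1). norm (grad (\<lambda>z. ineq P t z $ i) z) \<le> M3 K t) \<and>
          (Lipf K t)-lipschitz_on (XX P t \<times> XX P (t - 1)) (cost P t) \<and>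
          (LipQ K (Suc t))-lipschitz_on (XX P t) (\<lambda>y. real_of_ereal (valfun P (Suc t) y)) \<and>
          0 < Lipg K t \<and>
          (\<forall>i. (Lipg K t)-lipschitz_on (XX P t \<times> XX P (t - 1)) (\<lambda>z. ineq P t z $ i)) \<and>
          rad K t \<le> kap K t / (2 * Lipg K t) \<and>
          0 < rho K t \<and>
          cball 0 (rho K t) \<inter> (*v) (matA P t) ` dir_space (XX P t)
            \<subseteq> (*v) (matA P t) ` (cball 0 (rad K t) \<inter> dir_space (XX P t))))"

definition U_const ::
  "('n::finite, 'p::finite, 'q::finite) problem \<Rightarrow> ('n, 'p, 'q) execution \<Rightarrow> bounds \<Rightarrow>
    (nat \<Rightarrow> real) \<Rightarrow> nat \<Rightarrow> real" where
  "U_const P R K \<epsilon>b t =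
    ((Lipf K t + LipQ K (Suc t)) * rad K t + \<epsilon>b t +
      (SUP z\<in>XX P t \<times> XX P (t - 1). cost P t z + real_of_ereal (valfun P (Suc t) (fst z))) -
      (INF x\<in>XX P (t - 1). real_of_ereal (underval P R t 1 x)))
    / min (rho K t) (kap K t / 2)"

definition L_const ::
  "('n::finite, 'p::finite, 'q::finite) problem \<Rightarrow> ('n, 'p, 'q) execution \<Rightarrow> bounds \<Rightarrow>
    (nat \<Rightarrow> real) \<Rightarrow> nat \<Rightarrow> real" where
  "L_const P R K \<epsilon>b t =
    (if horizon P < t then 0
     else case stype P t of
       S1 \<Rightarrow> M2 K t
     | S2 \<Rightarrow> M2 K t +
         sqrt 2 * max (onorm ((*v) (transpose (matB P t)))) (M3 K t * sqrt (real CARD('p)))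
           * U_const P R K \<epsilon>b t)"

definition eta_bar ::
  "('n::finite, 'p::finite, 'q::finite) problem \<Rightarrow> ('n, 'p, 'q) execution \<Rightarrow> bounds \<Rightarrow>
    (nat \<Rightarrow> real) \<Rightarrow> nat \<Rightarrow> real" where
  "eta_bar P R K \<epsilon>b t =
    (case stype P t of
       S1 \<Rightarrow> (M2 K t + L_const P R K \<epsilon>b (Suc t)) * diameter (XX P t)
     | S2 \<Rightarrow> (M2 K t +
         sqrt 2 * max (onorm ((*v) (transpose (matA P t)))) (M3 K t * sqrt (real CARD('p)))
           * U_const P R K \<epsilon>b t +
         L_const P R K \<epsilon>b (Suc t)) * diameter (XX P t))"

definition delta_bar ::
  "('n::finite, 'p::finite, 'q::finite) problem \<Rightarrow> ('n, 'p, 'q) execution \<Rightarrow> bounds \<Rightarrow>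
    (nat \<Rightarrow> real) \<Rightarrow> nat \<Rightarrow> real" where
  "delta_bar P R K \<epsilon>b t =
    (if t = 1 then 0
     else case stype P t of
       S1 \<Rightarrow> eta_bar P R K \<epsilon>b t
     | S2 \<Rightarrow> eta_bar P R K \<epsilon>b t + \<epsilon>b t)"

text \<open>With a single stage there is no cut, and the empty maximum is read as \<open>delta_bar \<dots> 1 = 0\<close>.\<close>

definition delta_max ::
  "('n::finite, 'p::finite, 'q::finite) problem \<Rightarrow> ('n, 'p, 'q) execution \<Rightarrow> bounds \<Rightarrow>
    (nat \<Rightarrow> real) \<Rightarrow> real" where
  "delta_max P R K \<epsilon>b =
    (if horizon P = 1 then delta_bar P R K \<epsilon>b 1
     else (MAX t\<in>{2..horizon P}. delta_bar P R K \<epsilon>b t))"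

text \<open>\<open>z\<close> is an accumulation point of the sequence \<open>(x\<^sub>1\<^sup>k, \<dots>, x\<^sub>T\<^sup>k)\<close>; convergence of tuples
  is componentwise.\<close>

definition accumulation_traj ::
  "nat \<Rightarrow> (nat \<Rightarrow> nat \<Rightarrow> 'a::topological_space) \<Rightarrow> (nat \<Rightarrow> 'a) \<Rightarrow> bool" where
  "accumulation_traj T x z \<longleftrightarrow>
    (\<exists>s. strict_mono s \<and> (\<forall>t\<in>{1..T}. (\<lambda>j. x t (s j)) \<longlonglongrightarrow> z t))"

end

theory Submission
  imports Defs
begin

text \<open>Why the iterates approach optimality. At every stage the cut is a linearization of the Lagrangian
  of the stage problem, which is convex; the correction \<open>cut_eta\<close> absorbs the failure of optimality of
  the trial point, so every cut, and hence every \<open>\<Q>\<^sub>t\<^sup>k\<close>, lies below \<open>\<Q>\<^sub>t\<close> (\<open>cut_le_objective\<close>,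
  \<open>q_le_V\<close>).

  For the gap at the trial state, strong duality (\<open>slater_multipliers\<close>, obtained by separation of
  convex sets) says that \<open>cut_theta\<close> is within the dual noise of the stage minimum, so that the gap is
  at most \<open>cut_eta\<close> plus this noise. The Slater margin bounds the approximate multipliers by
  \<open>U_const\<close> (\<open>multiplier_bound\<close>); this bounds the gradients that enter the cuts, hence the slopes of
  the cuts by \<open>L_const\<close> and \<open>cut_eta\<close> by \<open>eta_bar\<close> (\<open>beta_bound\<close>, \<open>eta_bound\<close>, \<open>cut_gap\<close>).

  For accumulation points, write \<open>\<delta>\<close> and \<open>e\<close> for the uniform bounds on the gaps and the
  noises. Near-optimality of the forward point and the gap give
  \<open>\<Q>\<^sub>t\<^sup>k(x\<^sub>t\<^sub>-\<^sub>1\<^sup>k) \<ge> f\<^sub>t(x\<^sub>t\<^sup>k, x\<^sub>t\<^sub>-\<^sub>1\<^sup>k) + \<Q>\<^sub>t\<^sub>+\<^sub>1\<^sup>k\<^sup>-\<^sup>1(x\<^sub>t\<^sup>k) - e - \<delta>\<close>. The functions \<open>\<Q>\<^sub>t\<^sub>+\<^sub>1\<^sup>k\<close>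
  increase with \<open>k\<close> and have a common Lipschitz constant, so along a convergent subsequence
  \<open>\<Q>\<^sub>t\<^sub>+\<^sub>1\<^sup>k\<^sup>-\<^sup>1(x\<^sub>t\<^sup>k)\<close> can be replaced, up to a vanishing error, by the value of the previous selected
  iteration at its own iterate (\<open>lower_bound_step\<close>). Chaining these inequalities over all stages, with
  a different iteration at each stage, gives in the limit
  \<open>\<Sum>\<^sub>t f\<^sub>t(z\<^sub>t, z\<^sub>t\<^sub>-\<^sub>1) \<le> \<Q>\<^sub>1(x\<^sub>0) + T (e + \<delta>)\<close>, and \<open>T \<le> T (T + 1) / 2\<close>.\<close>

section \<open>Gradients of convex functions\<close>

lemma GDERIV_grad:
  fixes F :: "'a::euclidean_space \<Rightarrow> real"
  assumes "F differentiable (at z)"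
  shows "GDERIV F z :> grad F z"
proof -
  obtain D where D: "(F has_derivative D) (at z)"
    using assms by (auto simp: differentiable_def)
  have lin: "linear D"
    using D has_derivative_linear by blast
  have "D = (\<lambda>h. h \<bullet> adjoint D 1)"
    using adjoint_works[OF lin] by auto
  then have G: "GDERIV F z :> adjoint D 1"
    using D by (metis gderiv_def)
  have "D' = adjoint D 1" if "GDERIV F z :> D'" for D'
  proof -
    have "(\<lambda>h. h \<bullet> D') = (\<lambda>h. h \<bullet> adjoint D 1)"
      using that G unfolding gderiv_def by (rule has_derivative_unique)
    then show ?thesis
      by (metis vector_eq_ldot)
  qed
  then show ?thesis
    unfolding grad_def using G by (rule theI[rotated])
qed

lemma grad_eqI: "GDERIV F z :> D \<Longrightarrow> grad F z = D" for F :: "'a::euclidean_space \<Rightarrow> real"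
proof -
  assume *: "GDERIV F z :> D"
  then have "GDERIV F z :> grad F z"
    by (intro GDERIV_grad) (auto simp: gderiv_def differentiable_def)
  with * have "(\<lambda>h. h \<bullet> D) = (\<lambda>h. h \<bullet> grad F z)"
    unfolding gderiv_def by (rule has_derivative_unique)
  then show ?thesis
    by (metis vector_eq_ldot)
qed

lemma grad1_eq_fst:
  fixes F :: "'a::euclidean_space \<times> 'b::euclidean_space \<Rightarrow> real"
  assumes "F differentiable (at z)"
  shows "grad1 F z = fst (grad F z)"
  unfolding grad1_def
proof (rule grad_eqI, unfold gderiv_def)
  have "(F has_derivative (\<lambda>h. h \<bullet> grad F z)) (at (fst z, snd z))"
    using GDERIV_grad[OF assms] by (simp add: gderiv_def)
  moreover have "((\<lambda>u. (u, snd z)) has_derivative (\<lambda>h. (h, 0))) (at (fst z))"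
    by (auto intro!: derivative_eq_intros)
  ultimately have "((\<lambda>u. F (u, snd z)) has_derivative (\<lambda>h. (h, 0) \<bullet> grad F z)) (at (fst z))"
    by (rule has_derivative_compose[rotated])
  then show "((\<lambda>u. F (u, snd z)) has_derivative (\<lambda>h. h \<bullet> fst (grad F z))) (at (fst z))"
    by (simp add: inner_prod_def)
qed

lemma grad2_eq_snd:
  fixes F :: "'a::euclidean_space \<times> 'b::euclidean_space \<Rightarrow> real"
  assumes "F differentiable (at z)"
  shows "grad2 F z = snd (grad F z)"
  unfolding grad2_def
proof (rule grad_eqI, unfold gderiv_def)
  have "(F has_derivative (\<lambda>h. h \<bullet> grad F z)) (at (fst z, snd z))"
    using GDERIV_grad[OF assms] by (simp add: gderiv_def)
  moreover have "((\<lambda>v. (fst z, v)) has_derivative (\<lambda>h. (0, h))) (at (snd z))"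
    by (auto intro!: derivative_eq_intros)
  ultimately have "((\<lambda>v. F (fst z, v)) has_derivative (\<lambda>h. (0, h) \<bullet> grad F z)) (at (snd z))"
    by (rule has_derivative_compose[rotated])
  then show "((\<lambda>v. F (fst z, v)) has_derivative (\<lambda>h. h \<bullet> snd (grad F z))) (at (snd z))"
    by (simp add: inner_prod_def)
qed

lemma norm_grad1_le:
  fixes F :: "'a::euclidean_space \<times> 'b::euclidean_space \<Rightarrow> real"
  shows "F differentiable (at z) \<Longrightarrow> norm (grad1 F z) \<le> norm (grad F z)"
  using norm_fst_le[of "fst (grad F z)" "snd (grad F z)"] by (simp add: grad1_eq_fst)

lemma norm_grad2_le:
  fixes F :: "'a::euclidean_space \<times> 'b::euclidean_space \<Rightarrow> real"
  shows "F differentiable (at z) \<Longrightarrow> norm (grad2 F z) \<le> norm (grad F z)"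
  using norm_snd_le[of "snd (grad F z)" "fst (grad F z)"] by (simp add: grad2_eq_snd)

text \<open>The difference quotients at \<open>0\<close> of \<open>s \<mapsto> F (z + s (w - z))\<close> are at most \<open>F w - F z\<close> by
  convexity, and they converge to the slope of the tangent. Only \<open>s > 0\<close> is used, so \<open>z\<close> may lie
  on the boundary of \<open>S\<close>.\<close>

lemma convex_on_above_tangent:
  fixes F :: "'a::euclidean_space \<Rightarrow> real"
  assumes cvx: "convex_on S F" and "z \<in> S" "w \<in> S" and diff: "F differentiable (at z)"
  shows "F z + grad F z \<bullet> (w - z) \<le> F w"
proof -
  define \<phi> where "\<phi> = (\<lambda>s. F (z + s *\<^sub>R (w - z)))"
  have "(F has_derivative (\<lambda>h. h \<bullet> grad F z)) (at (z + 0 *\<^sub>R (w - z)))"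
    using GDERIV_grad[OF diff] by (simp add: gderiv_def)
  moreover have "((\<lambda>s. z + s *\<^sub>R (w - z)) has_derivative (\<lambda>s. s *\<^sub>R (w - z))) (at (0::real))"
    by (auto intro!: derivative_eq_intros)
  ultimately have "(\<phi> has_derivative (\<lambda>s. (s *\<^sub>R (w - z)) \<bullet> grad F z)) (at 0)"
    unfolding \<phi>_def by (rule has_derivative_compose[rotated])
  then have "(\<phi> has_real_derivative grad F z \<bullet> (w - z)) (at 0)"
    unfolding has_field_derivative_def by (simp add: inner_commute mult.commute[of _ "_ \<bullet> _"] fun_eq_iff)
  then have "((\<lambda>s. (\<phi> s - \<phi> 0) / s) \<longlongrightarrow> grad F z \<bullet> (w - z)) (at_right 0)"
    by (auto simp: has_field_derivative_iff intro: tendsto_mono[OF at_le])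
  moreover have "\<forall>\<^sub>F s in at_right (0::real). s \<in> {0<..<1}"
    by (rule eventually_at_right_real) simp
  then have "\<forall>\<^sub>F s in at_right 0. (\<phi> s - \<phi> 0) / s \<le> F w - F z"
  proof eventually_elim
    case (elim s)
    have "\<phi> s = F ((1 - s) *\<^sub>R z + s *\<^sub>R w)"
      by (simp add: \<phi>_def algebra_simps)
    also have "\<dots> \<le> (1 - s) * F z + s * F w"
      using convex_onD[OF cvx, of s z w] elim assms(2,3) by auto
    finally show ?case
      using elim by (simp add: \<phi>_def field_simps)
  qed
  ultimately have "grad F z \<bullet> (w - z) \<le> F w - F z"
    by (intro tendsto_upperbound) auto
  then show ?thesis by simp
qed

lemma convex_on_section:
  assumes "convex_on (S \<times> W) F" "convex S" "u \<in> W"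
  shows "convex_on S (\<lambda>y. F (y, u))"
proof (rule convex_onI)
  fix s :: real and y y' assume "0 < s" "s < 1" "y \<in> S" "y' \<in> S"
  then show "F ((1 - s) *\<^sub>R y + s *\<^sub>R y', u) \<le> (1 - s) * F (y, u) + s * F (y', u)"
    using convex_onD[OF assms(1), of s "(y, u)" "(y', u)"] assms(3)
    by (simp add: scaleR_left_distrib[symmetric])
qed fact

section \<open>Lagrange multipliers under a Slater condition\<close>

lemma affine_hull_plus_dir_space:
  assumes "x \<in> affine hull X" "d \<in> dir_space X"
  shows "x + c *\<^sub>R d \<in> affine hull X"
  using assms mem_affine_3_minus[OF affine_affine_hull] unfolding dir_space_def by blast

lemma subspace_dir_space:
  assumes "X \<noteq> {}"
  shows "subspace (dir_space X)"
proof (rule subspaceI)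
  obtain x where "x \<in> affine hull X"
    using assms by (meson all_not_in_conv hull_inc)
  then show "0 \<in> dir_space X"
    unfolding dir_space_def by force
next
  fix d e assume d: "d \<in> dir_space X" and e: "e \<in> dir_space X"
  then obtain x y where xy: "d = x - y" "x \<in> affine hull X" "y \<in> affine hull X"
    by (auto simp: dir_space_def)
  have "x + 1 *\<^sub>R e \<in> affine hull X"
    using affine_hull_plus_dir_space e xy by blast
  moreover have "d + e = (x + 1 *\<^sub>R e) - y"
    using xy by simp
  ultimately show "d + e \<in> dir_space X"
    unfolding dir_space_def using xy by blast
next
  fix c :: real and d assume d: "d \<in> dir_space X"
  then obtain x where x: "x \<in> affine hull X"
    by (auto simp: dir_space_def)
  have "c *\<^sub>R d = (x + c *\<^sub>R d) - x"
    by simp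
  then show "c *\<^sub>R d \<in> dir_space X"
    unfolding dir_space_def using affine_hull_plus_dir_space[OF x d] x by blast
qed

lemma nonneg_inner_neg_imp_zero:
  fixes m g :: "real^'p::finite"
  assumes "\<And>i. 0 \<le> m $ i" "\<And>i. g $ i < 0" "0 \<le> m \<bullet> g"
  shows "m = 0"
proof -
  have "(\<Sum>i\<in>UNIV. m $ i * - (g $ i)) \<le> 0"
    using assms(3) by (simp add: inner_vec_def sum_negf)
  moreover have "\<And>i. 0 \<le> m $ i * - (g $ i)"
    using assms(1,2) by (simp add: less_imp_le mult_nonneg_nonpos)
  ultimately have "\<forall>i\<in>UNIV. m $ i * - (g $ i) = 0"
    by (metis (mono_tags, lifting) finite_class.finite_UNIV order_antisym sum_nonneg sum_nonneg_eq_0_iff)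
  then show ?thesis
    using assms(2) by (metis UNIV_I less_irrefl mult_eq_0_iff neg_equal_0_iff_equal vec_eq_iff zero_index)
qed

text \<open>Lagrange duality for a convex program with affine and convex constraints. Separate the point
  \<open>(0, 0, v)\<close> from the convex set of triples that lie above the constraint and objective values. The
  separating normal \<open>(l, m, \<tau>)\<close> can be taken parallel to the affine hull of the two, which puts \<open>l\<close>
  into the image of \<open>dir_space X\<close>. Its last component is positive because of the Slater point, and
  dividing by it gives the multipliers.\<close>

lemma slater_multipliers:
  fixes A :: "'a::euclidean_space \<Rightarrow> 'b::euclidean_space"
    and G :: "'a \<Rightarrow> real^'p::finite"
  assumes cvx: "convex_on X \<phi>" "\<And>i. convex_on X (\<lambda>y. G y $ i)" and A: "linear A"
    and slater: "y0 \<in> X" "0 < r" "cball y0 r \<inter> affine hull X \<subseteq> X" "A y0 = b" "\<And>i. G y0 $ i < 0"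
    and lower: "\<And>y. y \<in> X \<Longrightarrow> A y = b \<Longrightarrow> (\<And>i. G y $ i \<le> 0) \<Longrightarrow> v \<le> \<phi> y"
  obtains l m where "l \<in> A ` dir_space X" "\<And>i. 0 \<le> m $ i"
    "\<And>y. y \<in> X \<Longrightarrow> v \<le> \<phi> y + l \<bullet> (A y - b) + m \<bullet> G y"
proof -
  define C where "C = {(A y - b, G y + u, \<phi> y + s) |y u s. y \<in> X \<and> (\<forall>i. 0 \<le> u $ i) \<and> 0 < (s::real)}"
  define H where "H = A ` dir_space X \<times> (UNIV :: (real^'p) set) \<times> (UNIV :: real set)"
  have C_I: "(A y - b, G y + u, \<phi> y + s) \<in> C" if "y \<in> X" "\<forall>i. 0 \<le> u $ i" "0 < s" for y u s
    using that unfolding C_def by blast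
  have cX: "convex X"
    using cvx(1) by (auto simp: convex_on_def)
  have "convex C"
    unfolding convex_def
  proof (intro ballI allI impI)
    fix c d :: "'b \<times> (real^'p) \<times> real" and \<alpha> \<beta> :: real
    assume "c \<in> C" "d \<in> C" and ab: "0 \<le> \<alpha>" "0 \<le> \<beta>" "\<alpha> + \<beta> = 1"
    then obtain y u s y' u' s' where
      c: "c = (A y - b, G y + u, \<phi> y + s)" "y \<in> X" "\<forall>i. 0 \<le> u $ i" "0 < s" and
      d: "d = (A y' - b, G y' + u', \<phi> y' + s')" "y' \<in> X" "\<forall>i. 0 \<le> u' $ i" "0 < s'"
      unfolding C_def by blast
    define w where "w = \<alpha> *\<^sub>R y + \<beta> *\<^sub>R y'"
    define u'' where "u'' = \<alpha> *\<^sub>R (G y + u) + \<beta> *\<^sub>R (G y' + u') - G w"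
    define s'' where "s'' = \<alpha> * (\<phi> y + s) + \<beta> * (\<phi> y' + s') - \<phi> w"
    have w: "w \<in> X"
      using cX c d ab by (simp add: convex_def w_def)
    have Gw: "G w $ i \<le> \<alpha> * G y $ i + \<beta> * G y' $ i" for i
      using cvx(2)[of i] c d ab by (simp add: convex_on_def w_def)
    have uu: "0 \<le> \<alpha> * u $ i + \<beta> * u' $ i" for i
      using c d ab by simp
    have "0 \<le> u'' $ i" for i
      using Gw[of i] uu[of i] by (simp add: u''_def distrib_left)
    then have u'': "\<forall>i. 0 \<le> u'' $ i" by blast
    have "\<phi> w \<le> \<alpha> * \<phi> y + \<beta> * \<phi> y'"
      using cvx(1) c d ab by (simp add: convex_on_def w_def)
    moreover have "0 < \<alpha> * s + \<beta> * s'"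
    proof (cases "\<alpha> = 0")
      case False
      then show ?thesis
        using c d ab by (intro add_pos_nonneg mult_pos_pos mult_nonneg_nonneg) auto
    qed (use d ab in auto)
    ultimately have s'': "0 < s''"
      by (simp add: s''_def algebra_simps)
    have "\<alpha> *\<^sub>R (A y - b) + \<beta> *\<^sub>R (A y' - b) = A w - (\<alpha> + \<beta>) *\<^sub>R b"
      by (simp add: w_def linear_add[OF A] linear_scale[OF A] algebra_simps)
    then have "\<alpha> *\<^sub>R c + \<beta> *\<^sub>R d = (A w - b, G w + u'', \<phi> w + s'')"
      using ab by (simp add: c d u''_def s''_def)
    then show "\<alpha> *\<^sub>R c + \<beta> *\<^sub>R d \<in> C"
      using C_I[OF w u'' s''] by simp
  qed
  moreover have "C \<noteq> {}"
    using C_I[OF slater(1), of 0 1] by auto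
  moreover have "(0, 0, v) \<notin> C"
  proof
    assume "(0, 0, v) \<in> C"
    then obtain y u s where y: "y \<in> X" "A y = b" "G y + u = 0" "\<forall>i. 0 \<le> u $ i" "v = \<phi> y + s" "0 < s"
      unfolding C_def by auto
    have "G y $ i \<le> 0" for i
    proof -
      have "(G y + u) $ i = 0"
        using y(3) by simp
      then show ?thesis
        using y(4)[rule_format, of i] by simp
    qed
    then show False
      using lower[of y] y by force
  qed
  ultimately obtain a \<alpha> where a: "(0, 0, v) + a \<in> affine hull (insert (0, 0, v) C)" "a \<noteq> 0"
      "a \<bullet> (0, 0, v) \<le> \<alpha>" "\<And>c. c \<in> C \<Longrightarrow> \<alpha> \<le> a \<bullet> c"
    using separating_hyperplane_set_point_inaff by blast
  obtain l m \<tau> where a_eq: "a = (l, m, \<tau>)"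
    by (metis prod.exhaust)
  have "X \<noteq> {}"
    using slater by blast
  then have sub: "subspace (A ` dir_space X)"
    using subspace_dir_space A linear_subspace_image by blast
  then have "subspace H"
    unfolding H_def by (intro subspace_Times subspace_UNIV)
  have "A y - b \<in> A ` dir_space X" if "y \<in> X" for y
  proof -
    have "y - y0 \<in> dir_space X"
      unfolding dir_space_def
      using hull_inc[OF that, of affine] hull_inc[OF slater(1), of affine] by blast
    then show ?thesis
      using slater(4) linear_diff[OF A] by (metis image_eqI)
  qed
  then have "insert (0, 0, v) C \<subseteq> H"
    using subspace_0[OF sub] by (auto simp: C_def H_def)
  then have "affine hull (insert (0, 0, v) C) \<subseteq> H"
    by (simp add: \<open>subspace H\<close> hull_minimal subspace_imp_affine)
  then have l: "l \<in> A ` dir_space X"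
    using a(1) by (auto simp: a_eq H_def)
  have sep: "\<tau> * v \<le> l \<bullet> (A y - b) + m \<bullet> (G y + u) + \<tau> * (\<phi> y + s)"
    if "y \<in> X" "\<forall>i. 0 \<le> u $ i" "0 < s" for y u s
    using a(3) a(4)[OF C_I[OF that]] by (simp add: a_eq)
  \<comment> \<open>The set is unbounded upwards in these components, so a negative coefficient would make the
    functional unbounded below on it.\<close>
  have m: "0 \<le> m $ i" for i
  proof (rule ccontr)
    assume neg: "\<not> 0 \<le> m $ i"
    define c where "c = l \<bullet> (A y0 - b) + m \<bullet> G y0 + \<tau> * (\<phi> y0 + 1) - \<tau> * v"
    define u where "u = ((\<bar>c\<bar> + 1) / - m $ i) *\<^sub>R (axis i 1 :: real^'p)"
    have "\<forall>j. 0 \<le> u $ j"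
      using neg by (auto simp: u_def axis_def intro!: divide_nonneg_neg)
    moreover have "m \<bullet> u = - (\<bar>c\<bar> + 1)"
      using neg by (simp add: u_def inner_axis field_simps)
    ultimately show False
      using sep[OF slater(1), of u 1] by (simp add: c_def inner_add_right)
  qed
  have \<tau>0: "0 \<le> \<tau>"
  proof (rule ccontr)
    assume neg: "\<not> 0 \<le> \<tau>"
    define c where "c = l \<bullet> (A y0 - b) + m \<bullet> G y0 + \<tau> * \<phi> y0 - \<tau> * v"
    define s where "s = (\<bar>c\<bar> + 1) / - \<tau>"
    have s: "0 < s" "\<tau> * s = - (\<bar>c\<bar> + 1)"
      using neg by (auto simp: s_def intro!: divide_pos_neg)
    have "0 \<le> c + \<tau> * s"
      using sep[OF slater(1), of 0 s] s(1) by (simp add: c_def distrib_left)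
    then show False
      using s(2) by simp
  qed
  \<comment> \<open>The slack of the last component can be made arbitrarily small.\<close>
  have base: "\<tau> * v \<le> l \<bullet> (A y - b) + m \<bullet> G y + \<tau> * \<phi> y" if "y \<in> X" for y
  proof (rule field_le_epsilon)
    fix e :: real assume "0 < e"
    have "\<tau> * (e / (\<tau> + 1)) \<le> e"
      using \<tau>0 \<open>0 < e\<close> by (simp add: field_simps)
    then show "\<tau> * v \<le> l \<bullet> (A y - b) + m \<bullet> G y + \<tau> * \<phi> y + e"
      using sep[OF that, of 0 "e / (\<tau> + 1)"] \<tau>0 \<open>0 < e\<close> by (simp add: distrib_left)
  qed
  \<comment> \<open>If \<open>\<tau> = 0\<close>, the Slater point forces \<open>m = 0\<close>; moving from it by a small step against
    a preimage of \<open>l\<close> stays in \<open>X\<close> and forces \<open>l = 0\<close>.\<close>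
  have "\<tau> \<noteq> 0"
  proof
    assume "\<tau> = 0"
    then have pos: "0 \<le> l \<bullet> (A y - b) + m \<bullet> G y" if "y \<in> X" for y
      using base[OF that] by simp
    have "m = 0"
      using pos[OF slater(1)] slater(4,5) m by (intro nonneg_inner_neg_imp_zero[of m "G y0"]) auto
    obtain d where d: "d \<in> dir_space X" "l = A d"
      using l by blast
    define c where "c = r / (norm d + 1)"
    have c: "0 < c"
      using slater(2) by (simp add: c_def add_nonneg_pos)
    have "c * norm d \<le> c * (norm d + 1)"
      using c by simp
    also have "\<dots> = r"
      by (simp add: c_def add_nonneg_eq_0_iff)
    finally have "c * norm d \<le> r" .
    then have "y0 + (- c) *\<^sub>R d \<in> cball y0 r"
      using c by (simp add: dist_norm)
    then have "y0 + (- c) *\<^sub>R d \<in> X"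
      using slater(1,3) affine_hull_plus_dir_space[OF hull_inc d(1)] by blast
    then have "0 \<le> l \<bullet> (A (y0 + (- c) *\<^sub>R d) - b)"
      using pos \<open>m = 0\<close> by fastforce
    also have "\<dots> = - c * (l \<bullet> l)"
      using slater(4) d(2) by (simp add: linear_diff[OF A] linear_scale[OF A])
    finally have "l \<bullet> l \<le> 0"
      using c by (simp add: zero_le_mult_iff mult_le_0_iff)
    then have "l = 0"
      by (metis inner_gt_zero_iff not_le)
    then show False
      using a(2) \<open>m = 0\<close> \<open>\<tau> = 0\<close> by (simp add: a_eq zero_prod_def)
  qed
  with \<tau>0 have \<tau>: "0 < \<tau>" by simp
  show thesis
  proof
    show "(1 / \<tau>) *\<^sub>R l \<in> A ` dir_space X"
      using sub l by (rule subspace_scale)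
    show "0 \<le> ((1 / \<tau>) *\<^sub>R m) $ i" for i
      using m \<tau> by simp
    show "v \<le> \<phi> y + (1 / \<tau>) *\<^sub>R l \<bullet> (A y - b) + (1 / \<tau>) *\<^sub>R m \<bullet> G y" if "y \<in> X" for y
      using base[OF that] \<tau> by (simp add: field_simps)
  qed
qed

lemma norm_multiplier_combination_le:
  fixes M :: "real^'n::finite^'q::finite" and l :: "real^'q" and m :: "real^'p::finite"
  assumes "\<And>i. norm (d i) \<le> c"
  shows "norm (transpose M *v l + (\<Sum>i\<in>UNIV. m $ i *\<^sub>R d i))
    \<le> max (onorm ((*v) (transpose M))) (c * sqrt (real CARD('p))) * (norm l + norm m)"
    (is "_ \<le> ?N * _")
proof -
  have c: "0 \<le> c"
    using assms norm_ge_zero order_trans by blast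
  have "(\<Sum>i\<in>UNIV. \<bar>m $ i\<bar>)\<^sup>2 \<le> (\<Sum>i\<in>UNIV. \<bar>m $ i\<bar>\<^sup>2) * real CARD('p)"
    by (rule sum_squared_le_sum_of_squares)
  also have "\<dots> = (norm m * sqrt (real CARD('p)))\<^sup>2"
    by (simp add: norm_vec_def L2_set_def power_mult_distrib sum_nonneg)
  finally have l1: "(\<Sum>i\<in>UNIV. \<bar>m $ i\<bar>) \<le> norm m * sqrt (real CARD('p))"
    by (rule power2_le_imp_le) simp
  have "norm (\<Sum>i\<in>UNIV. m $ i *\<^sub>R d i) \<le> (\<Sum>i\<in>UNIV. \<bar>m $ i\<bar> * c)"
    by (rule sum_norm_le) (simp add: assms mult_left_mono)
  also have "\<dots> \<le> norm m * sqrt (real CARD('p)) * c"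
    using mult_right_mono[OF l1 c] by (simp add: sum_distrib_right)
  also have "\<dots> = c * sqrt (real CARD('p)) * norm m"
    by (simp only: mult_ac)
  also have "\<dots> \<le> ?N * norm m"
    by (intro mult_right_mono) auto
  finally have 2: "norm (\<Sum>i\<in>UNIV. m $ i *\<^sub>R d i) \<le> ?N * norm m" .
  have "norm (transpose M *v l) \<le> onorm ((*v) (transpose M)) * norm l"
    by (rule onorm) (rule matrix_vector_mul_bounded_linear)
  also have "\<dots> \<le> ?N * norm l"
    by (simp add: mult_right_mono)
  finally show ?thesis
    using norm_triangle_mono[OF _ 2] by (simp add: distrib_left del: transpose_matrix_vector)
qed

section \<open>Stage data of a run with bounded noises\<close>

lemma subset_enlarge: "X \<subseteq> enlarge e X"
  unfolding enlarge_def using centre_in_cball[of 0 1] by force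

locale noisy_iddp_run =
  fixes P :: "('n::finite, 'p::finite, 'q::finite) problem"
    and R :: "('n, 'p, 'q) execution"
    and K :: bounds
    and \<epsilon> :: "nat \<Rightarrow> nat \<Rightarrow> real"
    and \<epsilon>b :: "nat \<Rightarrow> real"
  assumes horizon_pos: "1 \<le> horizon P"
    and H1: "H1 P"
    and H2: "H2 P (kap K) (rad K)"
    and bounds: "valid_bounds P K"
    and noise: "\<And>t k. t \<in> {1..horizon P} \<Longrightarrow> 1 \<le> k \<Longrightarrow> 0 \<le> \<epsilon> t k \<and> \<epsilon> t k \<le> \<epsilon>b t"
    and run: "iddp_run P \<epsilon> R"
begin

abbreviation T :: nat where "T \<equiv> horizon P"
abbreviation X :: "nat \<Rightarrow> (real^'n) set" where "X \<equiv> XX P"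
abbreviation f :: "nat \<Rightarrow> (real^'n) \<times> (real^'n) \<Rightarrow> real" where "f \<equiv> cost P"
abbreviation x :: "nat \<Rightarrow> nat \<Rightarrow> real^'n" where "x \<equiv> fwd R"
abbreviation xB :: "nat \<Rightarrow> nat \<Rightarrow> real^'n" where "xB \<equiv> bwd R"

text \<open>Real-valued versions of \<open>\<Q>\<^sub>t\<close>, of \<open>\<Q>\<^sub>t\<^sup>k\<close> and of the minimum of \<open>F\<^sub>t\<^sup>k\<close>. For \<open>k \<ge> 1\<close>
  and at points of \<open>\<X>\<^sub>t\<^sub>-\<^sub>1\<close> the extended reals are finite, so nothing is lost.\<close>

definition V :: "nat \<Rightarrow> real^'n \<Rightarrow> real" where
  "V t u = real_of_ereal (valfun P t u)"

definition q :: "nat \<Rightarrow> nat \<Rightarrow> real^'n \<Rightarrow> real" where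
  "q t k u = real_of_ereal (approx P R t k u)"

definition low :: "nat \<Rightarrow> nat \<Rightarrow> real^'n \<Rightarrow> real" where
  "low t k u = real_of_ereal (underval P R t k u)"

lemma X_props:
  assumes "t \<le> T"
  shows "X t \<noteq> {}" "convex (X t)" "compact (X t)"
  using H1 assms unfolding H1_def by (cases "t = 0"; auto simp: XX_def)+

lemma cost_props:
  assumes "t \<in> {1..T}"
  shows "convex_on (X t \<times> X (t - 1)) (f t)"
    and "\<And>z. z \<in> X t \<times> X (t - 1) \<Longrightarrow> f t differentiable (at z)"
  using H1 assms unfolding H1_def C1_on_def by blast+

lemma ineq_props:
  assumes "t \<in> {1..T}" "stype P t = S2"
  shows "convex_on (X t \<times> X (t - 1)) (\<lambda>z. ineq P t z $ i)"
    and "\<And>z. z \<in> X t \<times> X (t - 1) \<Longrightarrow> (\<lambda>z. ineq P t z $ i) differentiable (at z)"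
proof -
  obtain e where e: "convex_on (X t \<times> enlarge e (X (t - 1))) (\<lambda>z. ineq P t z $ i)"
      "C1_on (X t \<times> X (t - 1)) (\<lambda>z. ineq P t z $ i)"
    using H1 assms unfolding H1_def by blast
  have "t - 1 \<le> T" "t \<le> T" using assms by auto
  then have "convex (X t \<times> X (t - 1))"
    using X_props by (intro convex_Times) auto
  then show "convex_on (X t \<times> X (t - 1)) (\<lambda>z. ineq P t z $ i)"
    using e(1) subset_enlarge by (elim convex_on_subset) auto
  show "\<And>z. z \<in> X t \<times> X (t - 1) \<Longrightarrow> (\<lambda>z. ineq P t z $ i) differentiable (at z)"
    using e(2) unfolding C1_on_def by blast
qed

lemma feas_subset: "feas P t u \<subseteq> X t"
  by (auto simp: feas_def split: stage_type.splits)

lemma feas_nonempty: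
  assumes "t \<in> {1..T}" "u \<in> X (t - 1)"
  shows "feas P t u \<noteq> {}"
proof (cases "stype P t")
  case S1
  then show ?thesis
    using X_props[of t] assms by (simp add: feas_def)
next
  case S2
  obtain e where "\<forall>u\<in>enlarge e (X (t - 1)). feas P t u \<inter> rel_interior (X t) \<noteq> {}"
    using H1 assms S2 unfolding H1_def by blast
  then show ?thesis
    using assms subset_enlarge by blast
qed

lemma fwd_feas:
  assumes "1 \<le> k" "t \<in> {1..T}"
  shows "x t k \<in> feas P t (x (t - 1) k)"
  using run assms unfolding iddp_run_def eps_min_def by blast

lemma fwd_0: "1 \<le> k \<Longrightarrow> x 0 k = x_init P"
  using run unfolding iddp_run_def by blast

lemma fwd_in:
  assumes "1 \<le> k" "t \<le> T"
  shows "x t k \<in> X t"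
proof (cases "t = 0")
  case True
  then show ?thesis
    using fwd_0 assms by (simp add: XX_def)
next
  case False
  then show ?thesis
    using fwd_feas[of k t] feas_subset assms by fastforce
qed

lemma bwd_feas:
  assumes "1 \<le> k" "t \<in> {2..T}"
  shows "xB t k \<in> feas P t (x (t - 1) k)"
  using run assms unfolding iddp_run_def eps_min_def by blast

lemma cutfun_eq:
  assumes "1 \<le> k" "t \<in> {2..T}"
  shows "cutfun R t k u = cut_theta P R t k - cut_eta P R t k + cut_beta P R t k \<bullet> (u - x (t - 1) k)"
  using run assms unfolding iddp_run_def by auto

lemma trial_in:
  assumes "1 \<le> k" "t \<in> {2..T}"
  shows "xB t k \<in> X t" "x (t - 1) k \<in> X (t - 1)" "trial R t k \<in> X t \<times> X (t - 1)"
  using bwd_feas[OF assms] feas_subset fwd_in[of k "t - 1"] assms by (auto simp: trial_def)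

lemma cost_bounded:
  assumes "t \<in> {1..T}"
  obtains C where "\<And>z. z \<in> X t \<times> X (t - 1) \<Longrightarrow> \<bar>f t z\<bar> \<le> C"
proof -
  have "t - 1 \<le> T" "t \<le> T"
    using assms by auto
  then have "compact (X t \<times> X (t - 1))"
    using X_props by (intro compact_Times) auto
  moreover have "continuous_on (X t \<times> X (t - 1)) (f t)"
    using cost_props(2)[OF assms] differentiable_imp_continuous_within
    by (blast intro: continuous_at_imp_continuous_on)
  ultimately have "bounded (f t ` (X t \<times> X (t - 1)))"
    by (intro compact_imp_bounded compact_continuous_image)
  then show thesis
    using that by (auto simp: bounded_iff)
qed

lemma valfun_eq_INF:
  assumes "t \<le> T"
  shows "valfun P t u = (INF y\<in>feas P t u. ereal (f t (y, u)) + valfun P (Suc t) y)"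
  using assms by (simp add: valfun.simps[of P t])

text \<open>Backward induction: the stage costs are bounded on compact sets, and no stage is infeasible
  from a point of \<open>\<X>\<^sub>t\<^sub>-\<^sub>1\<close>.\<close>

lemma valfun_bounded:
  assumes "t \<in> {1..Suc T}"
  shows "\<exists>C. \<forall>u\<in>X (t - 1). ereal (- C) \<le> valfun P t u \<and> valfun P t u \<le> ereal C"
proof -
  have "t \<le> Suc T" using assms by simp
  then show ?thesis
  proof (induction rule: inc_induct)
    case base
    then show ?case
      by (auto simp: valfun.simps intro!: exI[of _ 0])
  next
    case (step t)
    then have t: "t \<in> {1..T}" using assms by auto
    obtain C where C: "\<And>u. u \<in> X t \<Longrightarrow> ereal (- C) \<le> valfun P (Suc t) u \<and> valfun P (Suc t) u \<le> ereal C"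
      using step.IH by auto
    obtain D where D: "\<And>z. z \<in> X t \<times> X (t - 1) \<Longrightarrow> \<bar>f t z\<bar> \<le> D"
      using cost_bounded[OF t] by blast
    have "ereal (- (D + C)) \<le> valfun P t u \<and> valfun P t u \<le> ereal (D + C)" if u: "u \<in> X (t - 1)" for u
    proof
      have term_bound: "ereal (- (D + C)) \<le> ereal (f t (y, u)) + valfun P (Suc t) y \<and>
          ereal (f t (y, u)) + valfun P (Suc t) y \<le> ereal (D + C)" if y: "y \<in> feas P t u" for y
      proof -
        have yX: "y \<in> X t"
          using y feas_subset by blast
        have "\<bar>f t (y, u)\<bar> \<le> D"
          using D yX u by simp
        then show ?thesis
          using C[OF yX] by (cases "valfun P (Suc t) y") auto
      qed
      have eq: "valfun P t u = (INF y\<in>feas P t u. ereal (f t (y, u)) + valfun P (Suc t) y)"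
        using t by (simp add: valfun_eq_INF)
      show "ereal (- (D + C)) \<le> valfun P t u"
        unfolding eq using term_bound by (intro INF_greatest) blast
      obtain y where "y \<in> feas P t u"
        using feas_nonempty[OF t u] by blast
      then show "valfun P t u \<le> ereal (D + C)"
        unfolding eq using term_bound by (intro INF_lower2) auto
    qed
    then show ?case by blast
  qed
qed

lemma valfun_eq_V:
  assumes "t \<in> {1..Suc T}" "u \<in> X (t - 1)"
  shows "valfun P t u = ereal (V t u)"
  using valfun_bounded[OF assms(1)] assms(2) unfolding V_def
  by (cases "valfun P t u") fastforce+

lemma approx_eq_q: "1 \<le> k \<Longrightarrow> approx P R t k u = ereal (q t k u)"
  by (auto simp: q_def approx_def zero_ereal_def)

lemma q_after_horizon: "T < t \<Longrightarrow> q t k u = 0"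
  by (simp add: q_def approx_def)

lemma q_eq_Max: "1 \<le> k \<Longrightarrow> t \<le> T \<Longrightarrow> q t k u = (MAX j\<in>{1..k}. cutfun R t j u)"
  by (simp add: q_def approx_def)

lemma cut_le_q: "t \<le> T \<Longrightarrow> j \<in> {1..k} \<Longrightarrow> cutfun R t j u \<le> q t k u"
  by (subst q_eq_Max) auto

lemma q_attained:
  assumes "1 \<le> k" "t \<le> T"
  obtains j where "j \<in> {1..k}" "q t k u = cutfun R t j u"
proof -
  have "(MAX j\<in>{1..k}. cutfun R t j u) \<in> (\<lambda>j. cutfun R t j u) ` {1..k}"
    using assms by (intro Max_in) auto
  then show thesis
    using that q_eq_Max[OF assms] by auto
qed

lemma q_mono:
  assumes "1 \<le> i" "i \<le> k"
  shows "q t i u \<le> q t k u"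
proof (cases "t \<le> T")
  case True
  obtain j where "j \<in> {1..i}" "q t i u = cutfun R t j u"
    using q_attained assms True by blast
  then show ?thesis
    using cut_le_q[OF True, of j k] assms by simp
qed (simp add: q_after_horizon)

lemma q_convex:
  assumes "1 \<le> k" "2 \<le> t"
  shows "convex_on UNIV (q t k)"
proof (cases "t \<le> T")
  case True
  show ?thesis
  proof (rule convex_onI)
    fix s :: real and u v :: "real^'n"
    assume s: "0 < s" "s < 1"
    obtain j where j: "j \<in> {1..k}" "q t k ((1 - s) *\<^sub>R u + s *\<^sub>R v) = cutfun R t j ((1 - s) *\<^sub>R u + s *\<^sub>R v)"
      using q_attained[OF assms(1) True] by blast
    have "cutfun R t j ((1 - s) *\<^sub>R u + s *\<^sub>R v) = (1 - s) * cutfun R t j u + s * cutfun R t j v"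
      using j(1) assms True by (simp add: cutfun_eq inner_diff_right inner_add_right algebra_simps)
    also have "\<dots> \<le> (1 - s) * q t k u + s * q t k v"
      using s cut_le_q[OF True j(1)] by (intro add_mono mult_left_mono) auto
    finally show "q t k ((1 - s) *\<^sub>R u + s *\<^sub>R v) \<le> (1 - s) * q t k u + s * q t k v"
      using j(2) by simp
  qed simp
next
  case False
  then have "q t k = (\<lambda>_. 0)"
    by (auto simp: q_after_horizon)
  then show ?thesis
    by (simp add: convex_on_def)
qed

lemma q_continuous: "1 \<le> k \<Longrightarrow> 2 \<le> t \<Longrightarrow> continuous_on S (q t k)"
  using convex_on_continuous[OF open_UNIV q_convex] continuous_on_subset by blast

lemma q_lipschitz:
  assumes "1 \<le> k" "t \<in> {2..T}" and beta: "\<And>j. 1 \<le> j \<Longrightarrow> norm (cut_beta P R t j) \<le> L"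
  shows "q t k u - q t k v \<le> L * norm (u - v)"
proof -
  obtain j where j: "j \<in> {1..k}" "q t k u = cutfun R t j u"
    using q_attained[OF assms(1)] assms(2) by (metis atLeastAtMost_iff)
  have "q t k u - q t k v \<le> cutfun R t j u - cutfun R t j v"
    using j cut_le_q[of t j k v] assms(2) by simp
  also have "\<dots> = cut_beta P R t j \<bullet> (u - v)"
    using j assms by (simp add: cutfun_eq inner_diff_right)
  also have "\<dots> \<le> norm (cut_beta P R t j) * norm (u - v)"
    by (rule norm_cauchy_schwarz)
  also have "\<dots> \<le> L * norm (u - v)"
    using beta j by (intro mult_right_mono) auto
  finally show ?thesis .
qed

lemma stage_obj_eq: "1 \<le> k \<Longrightarrow> stage_obj P R t k y u = ereal (f t (y, u) + q (Suc t) k y)"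
  by (simp add: stage_obj_def approx_eq_q)

lemma underval_bounded_below:
  assumes "t \<in> {1..T}" "1 \<le> k"
  shows "\<exists>C. \<forall>u\<in>X (t - 1). ereal C \<le> underval P R t k u"
proof -
  obtain D where D: "\<And>z. z \<in> X t \<times> X (t - 1) \<Longrightarrow> \<bar>f t z\<bar> \<le> D"
    using cost_bounded[OF assms(1)] by blast
  have "bounded (q (Suc t) k ` X t)"
    using X_props[of t] assms q_continuous[of k "Suc t"]
    by (intro compact_imp_bounded compact_continuous_image) auto
  then obtain B where B: "\<And>y. y \<in> X t \<Longrightarrow> \<bar>q (Suc t) k y\<bar> \<le> B"
    by (auto simp: bounded_iff)
  have "ereal (- D - B) \<le> underval P R t k u" if u: "u \<in> X (t - 1)" for u
    unfolding underval_def
  proof (rule INF_greatest)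
    fix y assume "y \<in> feas P t u"
    then have y: "y \<in> X t" using feas_subset by blast
    then show "ereal (- D - B) \<le> stage_obj P R t k y u"
      using D[of "(y, u)"] B[OF y] u assms by (auto simp: stage_obj_eq)
  qed
  then show ?thesis by blast
qed

lemma underval_le:
  assumes "1 \<le> k" "y \<in> feas P t u"
  shows "underval P R t k u \<le> ereal (f t (y, u) + q (Suc t) k y)"
  unfolding underval_def stage_obj_eq[OF assms(1)] using assms by (rule_tac INF_lower)

lemma underval_eq_low:
  assumes "t \<in> {1..T}" "1 \<le> k" "u \<in> X (t - 1)"
  shows "underval P R t k u = ereal (low t k u)"
proof -
  obtain C where "ereal C \<le> underval P R t k u"
    using underval_bounded_below assms by blast
  moreover obtain y where "y \<in> feas P t u"
    using feas_nonempty assms by blast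
  then have "underval P R t k u \<le> ereal (f t (y, u) + q (Suc t) k y)"
    using underval_le assms by blast
  ultimately show ?thesis
    unfolding low_def by (cases "underval P R t k u") auto
qed

lemma low_le:
  assumes "t \<in> {1..T}" "1 \<le> k" "u \<in> X (t - 1)" "y \<in> feas P t u"
  shows "low t k u \<le> f t (y, u) + q (Suc t) k y"
  using underval_le[OF assms(2,4)] underval_eq_low[OF assms(1-3)] by simp

lemma low_greatest:
  assumes "t \<in> {1..T}" "1 \<le> k" "u \<in> X (t - 1)" "\<And>y. y \<in> feas P t u \<Longrightarrow> c \<le> f t (y, u) + q (Suc t) k y"
  shows "c \<le> low t k u"
proof -
  have "ereal c \<le> underval P R t k u"
    unfolding underval_def stage_obj_eq[OF assms(2)] using assms(4) by (intro INF_greatest) simp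
  then show ?thesis
    using underval_eq_low[OF assms(1-3)] by simp
qed

lemma low_mono:
  assumes "t \<in> {1..T}" "1 \<le> i" "i \<le> k" "u \<in> X (t - 1)"
  shows "low t i u \<le> low t k u"
proof (rule low_greatest)
  fix y assume "y \<in> feas P t u"
  then have "low t i u \<le> f t (y, u) + q (Suc t) i y"
    using assms by (intro low_le) auto
  then show "low t i u \<le> f t (y, u) + q (Suc t) k y"
    using q_mono[OF assms(2,3), of "Suc t" y] by simp
qed (use assms in auto)

section \<open>Validity of the cuts\<close>

text \<open>The Lagrangian at the multipliers computed by the run, without the term \<open>\<Q>\<^sub>t\<^sub>+\<^sub>1\<^sup>k\<close>. With zero
  multiplier terms at stages of type \<open>S1\<close>, both kinds of cut become linearizations of the same
  function.\<close>

definition lagr :: "nat \<Rightarrow> nat \<Rightarrow> real^'n \<Rightarrow> real^'n \<Rightarrow> real" where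
  "lagr t k y u = f t (y, u) +
    (case stype P t of S1 \<Rightarrow> 0 | S2 \<Rightarrow> lam R t k \<bullet> eq_resid P t y u + mu R t k \<bullet> ineq P t (y, u))"

lemma dual_solution:
  assumes "1 \<le> k" "t \<in> {2..T}" "stype P t = S2"
  shows "eps_max (\<epsilon> t k) (dual_fun P R t k (x (t - 1) k)) (dual_dom P t (x (t - 1) k)) (lam R t k, mu R t k)"
  using run assms unfolding iddp_run_def by blast

lemma mu_nonneg:
  assumes "1 \<le> k" "t \<in> {2..T}" "stype P t = S2"
  shows "0 \<le> mu R t k $ i"
  using dual_solution[OF assms] by (auto simp: eps_max_def dual_dom_def)

lemma lagr_le_cost:
  assumes "1 \<le> k" "t \<in> {2..T}" "y \<in> feas P t u"
  shows "lagr t k y u \<le> f t (y, u)"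
proof (cases "stype P t")
  case S2
  then have "\<And>i. ineq P t (y, u) $ i \<le> 0" "eq_resid P t y u = 0"
    using assms(3) by (auto simp: feas_def)
  moreover from this have "mu R t k \<bullet> ineq P t (y, u) \<le> 0"
    using mu_nonneg[OF assms(1,2) S2] by (auto simp: inner_vec_def mult_nonneg_nonpos intro!: sum_nonpos)
  ultimately show ?thesis
    using S2 by (simp add: lagr_def)
qed (simp add: lagr_def)

lemma theta_eq:
  assumes "1 \<le> k" "t \<in> {2..T}"
  shows "cut_theta P R t k = lagr t k (xB t k) (x (t - 1) k) + q (Suc t) k (xB t k)"
  using bwd_feas[OF assms]
  by (auto simp: cut_theta_def lagr_def q_def trial_def feas_def split: stage_type.splits)

text \<open>The Lagrangian is jointly convex in \<open>(y, u)\<close>, since the multipliers of the inequalities are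
  nonnegative; \<open>decision_slope\<close> and \<open>cut_beta\<close> are its two partial gradients at the trial point.\<close>

lemma lagr_above_tangent:
  assumes k: "1 \<le> k" and t: "t \<in> {2..T}" and y: "y \<in> X t" and u: "u \<in> X (t - 1)"
  shows "lagr t k (xB t k) (x (t - 1) k) + decision_slope P R t k \<bullet> (y - xB t k)
    + cut_beta P R t k \<bullet> (u - x (t - 1) k) \<le> lagr t k y u"
proof -
  let ?z = "trial R t k"
  define a where "a = y - xB t k"
  define b where "b = u - x (t - 1) k"
  have t1: "t \<in> {1..T}" using t by auto
  have z: "?z \<in> X t \<times> X (t - 1)" and w: "(y, u) \<in> X t \<times> X (t - 1)"
    using trial_in[OF k t] y u by auto
  have dz: "(y, u) - ?z = (a, b)"
    by (simp add: a_def b_def trial_def)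
  have tangent: "F ?z + grad1 F ?z \<bullet> a + grad2 F ?z \<bullet> b \<le> F (y, u)"
    if F: "convex_on (X t \<times> X (t - 1)) F" "F differentiable (at ?z)" for F
  proof -
    have "grad F ?z \<bullet> (a, b) = grad1 F ?z \<bullet> a + grad2 F ?z \<bullet> b"
      using F(2) by (simp add: grad1_eq_fst grad2_eq_snd inner_prod_def)
    then show ?thesis
      using convex_on_above_tangent[OF F(1) z w F(2)] dz by simp
  qed
  have cost: "f t ?z + grad1 (f t) ?z \<bullet> a + grad2 (f t) ?z \<bullet> b \<le> f t (y, u)"
    by (rule tangent[OF cost_props(1)[OF t1] cost_props(2)[OF t1 z]])
  show ?thesis
  proof (cases "stype P t")
    case S1
    then show ?thesis
      using cost by (simp add: lagr_def decision_slope_def cut_beta_def trial_def a_def b_def)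
  next
    case S2
    let ?g = "\<lambda>i z. ineq P t z $ i"
    let ?m = "mu R t k"
    have "(\<Sum>i\<in>UNIV. ?m $ i * (?g i ?z + grad1 (?g i) ?z \<bullet> a + grad2 (?g i) ?z \<bullet> b))
        \<le> (\<Sum>i\<in>UNIV. ?m $ i * ?g i (y, u))"
      by (intro sum_mono mult_left_mono mu_nonneg[OF k t S2]
          tangent[OF ineq_props(1)[OF t1 S2] ineq_props(2)[OF t1 S2 z]])
    then have ineq: "?m \<bullet> ineq P t ?z + (\<Sum>i\<in>UNIV. ?m $ i *\<^sub>R grad1 (?g i) ?z) \<bullet> a
        + (\<Sum>i\<in>UNIV. ?m $ i *\<^sub>R grad2 (?g i) ?z) \<bullet> b \<le> ?m \<bullet> ineq P t (y, u)"
      by (simp add: inner_vec_def[of ?m] inner_sum_left sum.distrib distrib_left)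
    have "eq_resid P t y u = eq_resid P t (xB t k) (x (t - 1) k) + (matA P t *v a + matB P t *v b)"
      by (simp add: eq_resid_def a_def b_def matrix_vector_mult_diff_distrib)
    then have "lam R t k \<bullet> eq_resid P t y u = lam R t k \<bullet> eq_resid P t (xB t k) (x (t - 1) k)
        + (transpose (matA P t) *v lam R t k) \<bullet> a + (transpose (matB P t) *v lam R t k) \<bullet> b"
      by (simp add: inner_add_right dot_lmul_matrix)
    then show ?thesis
      using cost ineq S2 unfolding a_def[symmetric] b_def[symmetric]
      by (simp add: lagr_def decision_slope_def cut_beta_def inner_add_left trial_def)
  qed
qed

lemma eta_upper:
  assumes "1 \<le> k" "t \<in> {2..T}" "y \<in> X t"
  shows "decision_slope P R t k \<bullet> (xB t k - y) + q (Suc t) k (xB t k) - q (Suc t) k y \<le> cut_eta P R t k"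
proof -
  have "compact ((\<lambda>y. decision_slope P R t k \<bullet> (xB t k - y) + q (Suc t) k (xB t k) - q (Suc t) k y) ` X t)"
    using assms X_props[of t] by (intro compact_continuous_image continuous_intros q_continuous) auto
  then show ?thesis
    unfolding cut_eta_def q_def[symmetric]
    by (intro cSUP_upper assms bounded_imp_bdd_above compact_imp_bounded)
qed

text \<open>At an inexact \<open>x\<^sub>t\<^sup>B\<^sup>k\<close> the first-order condition may fail; \<open>cut_eta\<close> is the largest
  amount by which it can fail, and subtracting it restores validity of the cut.\<close>

lemma cut_le_objective:
  assumes "1 \<le> k" "t \<in> {2..T}" "u \<in> X (t - 1)" "y \<in> feas P t u"
  shows "cutfun R t k u \<le> f t (y, u) + q (Suc t) k y"
proof -
  have y: "y \<in> X t"
    using assms(4) feas_subset by blast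
  have "decision_slope P R t k \<bullet> (xB t k - y) = - (decision_slope P R t k \<bullet> (y - xB t k))"
    by (simp add: inner_diff_right)
  then show ?thesis
    using lagr_above_tangent[OF assms(1,2) y assms(3)] lagr_le_cost[OF assms(1,2,4)]
      eta_upper[OF assms(1,2) y] cutfun_eq[OF assms(1,2)] theta_eq[OF assms(1,2)]
    by simp
qed

lemma q_le_V:
  assumes "t \<in> {2..Suc T}" "1 \<le> k" "u \<in> X (t - 1)"
  shows "q t k u \<le> V t u"
proof -
  have "t \<le> Suc T" using assms by simp
  then show ?thesis
    using assms(2,3)
  proof (induction arbitrary: k u rule: inc_induct)
    case base
    then show ?case
      by (simp add: q_after_horizon V_def valfun.simps)
  next
    case (step t)
    then have t: "t \<in> {2..T}" "t \<in> {1..T}" "t \<in> {1..Suc T}" "t \<le> T" using assms(1) by auto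
    obtain j where j: "j \<in> {1..k}" "q t k u = cutfun R t j u"
      using q_attained[OF step.prems(1) t(4)] by blast
    have "ereal (cutfun R t j u) \<le> valfun P t u"
      unfolding valfun_eq_INF[OF t(4)]
    proof (rule INF_greatest)
      fix y assume y: "y \<in> feas P t u"
      then have yX: "y \<in> X t" using feas_subset by blast
      have "cutfun R t j u \<le> f t (y, u) + V (Suc t) y"
        using cut_le_objective[of j t u y] step.IH[of j y] j t y yX step.prems(2) by force
      then show "ereal (cutfun R t j u) \<le> ereal (f t (y, u)) + valfun P (Suc t) y"
        using valfun_eq_V[of "Suc t" y] t yX by simp
    qed
    then show ?case
      using valfun_eq_V[OF t(3) step.prems(2)] j by simp
  qed
qed

lemma low_le_V:
  assumes "t \<in> {1..T}" "1 \<le> k" "u \<in> X (t - 1)"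
  shows "low t k u \<le> V t u"
proof -
  have "t \<le> T"
    using assms by simp
  have "ereal (low t k u) \<le> valfun P t u"
    unfolding valfun_eq_INF[OF \<open>t \<le> T\<close>]
  proof (rule INF_greatest)
    fix y assume y: "y \<in> feas P t u"
    then have yX: "y \<in> X t" using feas_subset by blast
    have "low t k u \<le> f t (y, u) + V (Suc t) y"
      using low_le[OF assms y] q_le_V[of "Suc t" k y] assms yX by force
    then show "ereal (low t k u) \<le> ereal (f t (y, u)) + valfun P (Suc t) y"
      using valfun_eq_V[of "Suc t" y] assms yX by simp
  qed
  then show ?thesis
    using valfun_eq_V[of t u] assms by simp
qed

section \<open>Strong duality and the size of the multipliers\<close>

lemma slater_point:
  assumes "t \<in> {2..T}" "stype P t = S2" "u \<in> X (t - 1)"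
  obtains y where "y \<in> X t" "cball y (rad K t) \<inter> affine hull X t \<subseteq> X t" "eq_resid P t y u = 0"
    "\<And>i. ineq P t (y, u) $ i \<le> - kap K t"
  using H2 assms unfolding H2_def by blast

lemma kap_rad_pos:
  assumes "t \<in> {2..T}" "stype P t = S2"
  shows "0 < kap K t" "0 < rad K t"
  using H2 assms unfolding H2_def by blast+

text \<open>Strong duality at the trial state: the exact dual value is at least the primal value, so the
  computed multipliers lose at most the noise of the dual problem.\<close>

lemma low_le_lagrangian:
  assumes k: "1 \<le> k" and t: "t \<in> {2..T}" and y: "y \<in> X t"
  shows "low t k (x (t - 1) k) \<le> lagr t k y (x (t - 1) k) + q (Suc t) k y
    + (case stype P t of S1 \<Rightarrow> 0 | S2 \<Rightarrow> \<epsilon> t k)"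
proof (cases "stype P t")
  case S1
  then show ?thesis
    using low_le[of t k "x (t - 1) k" y] trial_in[OF k t] k t y by (simp add: lagr_def feas_def)
next
  case S2
  define u where "u = x (t - 1) k"
  define v where "v = low t k u"
  have u: "u \<in> X (t - 1)" and t1: "t \<in> {1..T}" and "t \<le> T"
    using trial_in[OF k t] t by (auto simp: u_def)
  obtain y0 where y0: "y0 \<in> X t" "cball y0 (rad K t) \<inter> affine hull X t \<subseteq> X t" "eq_resid P t y0 u = 0"
      "\<And>i. ineq P t (y0, u) $ i \<le> - kap K t"
    using slater_point[OF t S2 u] by blast
  have cvx: "convex (X t)"
    using X_props \<open>t \<le> T\<close> by blast
  obtain l m where lm: "l \<in> (*v) (matA P t) ` dir_space (X t)" "\<And>i. 0 \<le> m $ i"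
    "\<And>y. y \<in> X t \<Longrightarrow> v \<le> (f t (y, u) + q (Suc t) k y)
        + l \<bullet> (matA P t *v y - (rhs P t - matB P t *v u)) + m \<bullet> ineq P t (y, u)"
  proof (rule slater_multipliers[of "X t" "\<lambda>y. f t (y, u) + q (Suc t) k y" "\<lambda>y. ineq P t (y, u)"
        "(*v) (matA P t)" y0 "rad K t" "rhs P t - matB P t *v u" v])
    show "convex_on (X t) (\<lambda>y. f t (y, u) + q (Suc t) k y)"
      using convex_on_section[OF cost_props(1)[OF t1] cvx u]
        convex_on_subset[OF q_convex[OF k] subset_UNIV cvx] t by (intro convex_on_add) auto
    show "convex_on (X t) (\<lambda>y. ineq P t (y, u) $ i)" for i
      using convex_on_section[OF ineq_props(1)[OF t1 S2] cvx u] .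
    show "matA P t *v y0 = rhs P t - matB P t *v u"
      using y0(3) by (simp add: eq_resid_def algebra_simps)
    show "ineq P t (y0, u) $ i < 0" for i
      using y0(4)[of i] kap_rad_pos[OF t S2] by simp
    show "v \<le> f t (y, u) + q (Suc t) k y"
      if "y \<in> X t" "matA P t *v y = rhs P t - matB P t *v u" "\<And>i. ineq P t (y, u) $ i \<le> 0" for y
      using low_le[OF t1 k u, of y] that S2 by (simp add: v_def feas_def eq_resid_def)
  qed (use y0 kap_rad_pos[OF t S2] in auto)
  have resid: "matA P t *v y - (rhs P t - matB P t *v u) = eq_resid P t y u" for y
    by (simp add: eq_resid_def)
  \<comment> \<open>Exact multipliers are admissible in the restricted dual, because a preimage of \<open>l\<close> can be
    added to the Slater point, whose residual vanishes.\<close>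
  have "(l, m) \<in> dual_dom P t u"
  proof -
    obtain d where d: "d \<in> dir_space (X t)" "l = matA P t *v d"
      using lm(1) by blast
    have "y0 + 1 *\<^sub>R d \<in> affine hull X t"
      using affine_hull_plus_dir_space[OF hull_inc[OF y0(1)] d(1)] .
    moreover have "eq_resid P t (y0 + 1 *\<^sub>R d) u = eq_resid P t y0 u + l"
      using d(2) by (simp add: eq_resid_def matrix_vector_right_distrib)
    then have "l = eq_resid P t (y0 + 1 *\<^sub>R d) u"
      using y0(3) by simp
    ultimately show ?thesis
      using lm(2) by (auto simp: dual_dom_def)
  qed
  then have "dual_fun P R t k u (l, m) \<le> dual_fun P R t k u (lam R t k, mu R t k) + ereal (\<epsilon> t k)"
    using dual_solution[OF k t S2] by (auto simp: eps_max_def u_def intro: SUP_upper order_trans)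
  moreover have "ereal v \<le> dual_fun P R t k u (l, m)"
    unfolding dual_fun_def prod.case
  proof (rule INF_greatest)
    fix y assume "y \<in> X t"
    then show "ereal v \<le> stage_obj P R t k y u + ereal (l \<bullet> eq_resid P t y u + m \<bullet> ineq P t (y, u))"
      using lm(3)[of y] by (simp add: stage_obj_eq[OF k] resid)
  qed
  moreover have "dual_fun P R t k u (lam R t k, mu R t k) \<le> ereal (lagr t k y u + q (Suc t) k y)"
    unfolding dual_fun_def prod.case
    by (rule INF_lower2[OF y]) (simp add: stage_obj_eq[OF k] lagr_def S2)
  ultimately have "ereal v \<le> ereal (lagr t k y u + q (Suc t) k y) + ereal (\<epsilon> t k)"
    by (meson add_right_mono order_trans)
  then show ?thesis
    using S2 by (simp add: v_def u_def)
qed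

lemma U_numerator_bounds:
  assumes t: "t \<in> {2..T}"
  shows "bdd_above ((\<lambda>z. f t z + real_of_ereal (valfun P (Suc t) (fst z))) ` (X t \<times> X (t - 1)))"
    and "bdd_below ((\<lambda>u. real_of_ereal (underval P R t 1 u)) ` X (t - 1))"
proof -
  have t1: "t \<in> {1..T}" "Suc t \<in> {1..Suc T}" using t by auto
  obtain D where D: "\<And>z. z \<in> X t \<times> X (t - 1) \<Longrightarrow> \<bar>f t z\<bar> \<le> D"
    using cost_bounded[OF t1(1)] by blast
  obtain C where C: "\<And>y. y \<in> X t \<Longrightarrow> valfun P (Suc t) y \<le> ereal C"
    using valfun_bounded[OF t1(2)] by auto
  have "f t z + real_of_ereal (valfun P (Suc t) (fst z)) \<le> D + C" if "z \<in> X t \<times> X (t - 1)" for z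
    using D[OF that] C[of "fst z"] valfun_eq_V[OF t1(2), of "fst z"] that
    by (intro add_mono) auto
  then show "bdd_above ((\<lambda>z. f t z + real_of_ereal (valfun P (Suc t) (fst z))) ` (X t \<times> X (t - 1)))"
    by (rule bdd_aboveI2)
  obtain B where B: "\<And>u. u \<in> X (t - 1) \<Longrightarrow> ereal B \<le> underval P R t 1 u"
    using underval_bounded_below[OF t1(1), of 1] by auto
  have "B \<le> real_of_ereal (underval P R t 1 u)" if "u \<in> X (t - 1)" for u
    using B[OF that] underval_eq_low[OF t1(1) _ that, of 1] by simp
  then show "bdd_below ((\<lambda>u. real_of_ereal (underval P R t 1 u)) ` X (t - 1))"
    by (rule bdd_belowI2)
qed

text \<open>Evaluate the Lagrangian at a point that is moved away from the Slater point so as to make the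
  equality residual equal to \<open>-\<rho>\<close> times the direction of \<open>\<lambda>\<close>, while the inequalities keep half of
  their slack. Large multipliers would push this value below the optimal value, against
  \<open>low_le_lagrangian\<close>.\<close>

lemma multiplier_bound:
  assumes k: "1 \<le> k" and t: "t \<in> {2..T}" and S2: "stype P t = S2"
  shows "norm (lam R t k) + norm (mu R t k) \<le> U_const P R K \<epsilon>b t"
proof -
  define u where "u = x (t - 1) k"
  define l where "l = lam R t k"
  define m where "m = mu R t k"
  have u: "u \<in> X (t - 1)" and t1: "t \<in> {1..T}"
    using trial_in[OF k t] t by (auto simp: u_def)
  have kr: "0 < kap K t" "0 < rad K t"
    using kap_rad_pos[OF t S2] by auto
  have vb: "(Lipf K t)-lipschitz_on (X t \<times> X (t - 1)) (f t)"
      "(LipQ K (Suc t))-lipschitz_on (X t) (\<lambda>y. real_of_ereal (valfun P (Suc t) y))"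
      "0 < Lipg K t" "\<And>i. (Lipg K t)-lipschitz_on (X t \<times> X (t - 1)) (\<lambda>z. ineq P t z $ i)"
      "rad K t \<le> kap K t / (2 * Lipg K t)" "0 < rho K t"
      "cball 0 (rho K t) \<inter> (*v) (matA P t) ` dir_space (X t)
            \<subseteq> (*v) (matA P t) ` (cball 0 (rad K t) \<inter> dir_space (X t))"
    using bounds t S2 unfolding valid_bounds_def by auto
  obtain y0 where y0: "y0 \<in> X t" "cball y0 (rad K t) \<inter> affine hull X t \<subseteq> X t" "eq_resid P t y0 u = 0"
      "\<And>i. ineq P t (y0, u) $ i \<le> - kap K t"
    using slater_point[OF t S2 u] by blast
  have sub: "subspace ((*v) (matA P t) ` dir_space (X t))"
    using y0(1) by (intro linear_subspace_image subspace_dir_space) auto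
  have "l \<in> (\<lambda>y. eq_resid P t y u) ` (affine hull X t)"
    using dual_solution[OF k t S2] by (auto simp: eps_max_def dual_dom_def l_def u_def)
  then obtain a where a: "a \<in> affine hull X t" "l = eq_resid P t a u"
    by blast
  have "l = eq_resid P t a u - eq_resid P t y0 u"
    using a(2) y0(3) by simp
  then have "l = matA P t *v (a - y0)"
    by (simp add: eq_resid_def matrix_vector_mult_diff_distrib)
  moreover have "a - y0 \<in> dir_space (X t)"
    unfolding dir_space_def using a(1) hull_inc[OF y0(1), of affine] by blast
  ultimately have l: "l \<in> (*v) (matA P t) ` dir_space (X t)"
    by blast
  \<comment> \<open>For \<open>l = 0\<close> division by zero gives \<open>w = 0\<close>, which serves as well.\<close>
  define w where "w = (- rho K t / norm l) *\<^sub>R l"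
  have "w \<in> cball 0 (rho K t)"
    using vb(6) by (simp add: w_def)
  moreover have "w \<in> (*v) (matA P t) ` dir_space (X t)"
    unfolding w_def by (rule subspace_scale[OF sub l])
  ultimately obtain d where d: "d \<in> dir_space (X t)" "norm d \<le> rad K t" "matA P t *v d = w"
    using vb(7) by force
  define y where "y = y0 + 1 *\<^sub>R d"
  have "y \<in> affine hull X t"
    unfolding y_def by (rule affine_hull_plus_dir_space[OF hull_inc[OF y0(1)] d(1)])
  moreover have "y \<in> cball y0 (rad K t)"
    using d(2) by (simp add: y_def dist_norm)
  ultimately have y: "y \<in> X t"
    using y0(2) by blast
  have "eq_resid P t y u = eq_resid P t y0 u + w"
    using d(3) by (simp add: eq_resid_def y_def matrix_vector_right_distrib)
  then have "eq_resid P t y u = w"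
    using y0(3) by simp
  moreover have "l \<bullet> w = - rho K t * norm l"
    by (simp add: w_def dot_square_norm power2_eq_square)
  ultimately have eq_part: "l \<bullet> eq_resid P t y u = - rho K t * norm l"
    by simp
  have g: "ineq P t (y, u) $ i \<le> - kap K t / 2" for i
  proof -
    have "\<bar>ineq P t (y, u) $ i - ineq P t (y0, u) $ i\<bar> \<le> Lipg K t * norm d"
      using lipschitz_onD[OF vb(4)[of i], of "(y, u)" "(y0, u)"] y y0(1) u
      by (simp add: dist_norm y_def norm_prod_def)
    also have "\<dots> \<le> Lipg K t * (kap K t / (2 * Lipg K t))"
      using d(2) vb(3,5) by (intro mult_left_mono) auto
    also have "\<dots> = kap K t / 2"
      using vb(3) by simp
    finally show ?thesis
      using y0(4)[of i] by linarith
  qed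
  have m: "0 \<le> m $ i" for i
    using mu_nonneg[OF k t S2] by (simp add: m_def)
  have "m \<bullet> ineq P t (y, u) \<le> (\<Sum>i\<in>UNIV. m $ i * (- kap K t / 2))"
    unfolding inner_vec_def inner_real_def using g m by (intro sum_mono mult_left_mono) auto
  also have "\<dots> = - (kap K t / 2) * (\<Sum>i\<in>UNIV. \<bar>m $ i\<bar>)"
    unfolding sum_distrib_right[symmetric] using m by simp
  also have "\<dots> \<le> - (kap K t / 2) * norm m"
    using norm_le_l1_cart[of m] kr by (intro mult_left_mono_neg) auto
  finally have ineq_part: "m \<bullet> ineq P t (y, u) \<le> - (kap K t / 2) * norm m" .
  have "low t 1 u \<le> low t k u"
    using low_mono[OF t1 _ k u] by simp
  also have "\<dots> \<le> f t (y, u) + (l \<bullet> eq_resid P t y u + m \<bullet> ineq P t (y, u)) + q (Suc t) k y + \<epsilon> t k"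
    using low_le_lagrangian[OF k t y] S2 by (simp add: lagr_def u_def l_def m_def)
  also have "\<dots> \<le> f t (y, u) - rho K t * norm l - (kap K t / 2) * norm m + V (Suc t) y + \<epsilon>b t"
    using eq_part ineq_part q_le_V[of "Suc t" k y] noise[OF t1 k] t k y by force
  finally have "rho K t * norm l + (kap K t / 2) * norm m \<le> f t (y, u) + V (Suc t) y + \<epsilon>b t - low t 1 u"
    by simp
  moreover have "f t (y, u) + V (Suc t) y
      \<le> (SUP z\<in>X t \<times> X (t - 1). f t z + real_of_ereal (valfun P (Suc t) (fst z)))"
    using cSUP_upper[OF _ U_numerator_bounds(1)[OF t], of "(y, u)"] y u by (simp add: V_def)
  moreover have "(INF u\<in>X (t - 1). real_of_ereal (underval P R t 1 u)) \<le> low t 1 u"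
    unfolding low_def by (rule cINF_lower[OF U_numerator_bounds(2)[OF t] u])
  moreover have "0 \<le> (Lipf K t + LipQ K (Suc t)) * rad K t"
    using lipschitz_on_nonneg[OF vb(1)] lipschitz_on_nonneg[OF vb(2)] kr by simp
  moreover have "min (rho K t) (kap K t / 2) * norm l \<le> rho K t * norm l"
      "min (rho K t) (kap K t / 2) * norm m \<le> (kap K t / 2) * norm m"
    by (intro mult_right_mono; simp)+
  ultimately have "(norm l + norm m) * min (rho K t) (kap K t / 2)
    \<le> (Lipf K t + LipQ K (Suc t)) * rad K t + \<epsilon>b t +
      (SUP z\<in>X t \<times> X (t - 1). f t z + real_of_ereal (valfun P (Suc t) (fst z))) -
      (INF u\<in>X (t - 1). real_of_ereal (underval P R t 1 u))"
    by (simp add: algebra_simps)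
  then show ?thesis
    unfolding U_const_def l_def m_def using vb(6) kr by (subst pos_le_divide_eq) auto
qed

section \<open>Slopes and errors of the cuts\<close>

lemma grad_cost_bound:
  assumes "1 \<le> k" "t \<in> {2..T}"
  shows "norm (grad1 (f t) (trial R t k)) \<le> M2 K t" "norm (grad2 (f t) (trial R t k)) \<le> M2 K t"
proof -
  have z: "trial R t k \<in> X t \<times> X (t - 1)"
    using trial_in[OF assms] by blast
  have "f t differentiable (at (trial R t k))"
    using cost_props(2)[OF _ z] assms by auto
  moreover have "\<forall>z\<in>X t \<times> X (t - 1). norm (grad (f t) z) \<le> M2 K t"
    using bounds assms(2) unfolding valid_bounds_def by blast
  then have "norm (grad (f t) (trial R t k)) \<le> M2 K t"
    using z by (rule bspec)
  ultimately show "norm (grad1 (f t) (trial R t k)) \<le> M2 K t" "norm (grad2 (f t) (trial R t k)) \<le> M2 K t"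
    by (blast intro: order_trans[OF norm_grad1_le] order_trans[OF norm_grad2_le])+
qed

lemma grad_ineq_bound:
  assumes "1 \<le> k" "t \<in> {2..T}" "stype P t = S2"
  shows "norm (grad1 (\<lambda>z. ineq P t z $ i) (trial R t k)) \<le> M3 K t"
    "norm (grad2 (\<lambda>z. ineq P t z $ i) (trial R t k)) \<le> M3 K t"
proof -
  have z: "trial R t k \<in> X t \<times> X (t - 1)"
    using trial_in[OF assms(1,2)] by blast
  have "(\<lambda>z. ineq P t z $ i) differentiable (at (trial R t k))"
    using ineq_props(2)[OF _ _ z] assms by auto
  moreover have "\<forall>z\<in>X t \<times> X (t - 1). norm (grad (\<lambda>z. ineq P t z $ i) z) \<le> M3 K t"
    using bounds assms(2,3) unfolding valid_bounds_def by blast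
  then have "norm (grad (\<lambda>z. ineq P t z $ i) (trial R t k)) \<le> M3 K t"
    using z by (rule bspec)
  ultimately show "norm (grad1 (\<lambda>z. ineq P t z $ i) (trial R t k)) \<le> M3 K t"
      "norm (grad2 (\<lambda>z. ineq P t z $ i) (trial R t k)) \<le> M3 K t"
    by (blast intro: order_trans[OF norm_grad1_le] order_trans[OF norm_grad2_le])+
qed

lemma slope_bound:
  fixes M :: "real^'n^'q" and c :: "real^'n" and d :: "'p \<Rightarrow> real^'n"
  assumes "1 \<le> k" "t \<in> {2..T}" "stype P t = S2" and c: "norm c \<le> M2 K t" and d: "\<And>i. norm (d i) \<le> M3 K t"
  shows "norm (c + (transpose M *v lam R t k + (\<Sum>i\<in>UNIV. mu R t k $ i *\<^sub>R d i)))
    \<le> M2 K t + sqrt 2 * max (onorm ((*v) (transpose M))) (M3 K t * sqrt (real CARD('p))) * U_const P R K \<epsilon>b t"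
proof -
  define N where "N = max (onorm ((*v) (transpose M))) (M3 K t * sqrt (real CARD('p)))"
  have "0 \<le> onorm ((*v) (transpose M))"
    by (rule onorm_pos_le) (rule matrix_vector_mul_bounded_linear)
  then have N: "0 \<le> N"
    by (simp add: N_def)
  have U: "norm (lam R t k) + norm (mu R t k) \<le> U_const P R K \<epsilon>b t"
    by (rule multiplier_bound) fact+
  then have "0 \<le> U_const P R K \<epsilon>b t"
    by (smt (verit) norm_ge_zero)
  then have "1 * (N * U_const P R K \<epsilon>b t) \<le> sqrt 2 * (N * U_const P R K \<epsilon>b t)"
    using N by (intro mult_right_mono) auto
  moreover have "N * (norm (lam R t k) + norm (mu R t k)) \<le> N * U_const P R K \<epsilon>b t"
    using U N by (rule mult_left_mono)
  moreover have "norm (transpose M *v lam R t k + (\<Sum>i\<in>UNIV. mu R t k $ i *\<^sub>R d i))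
      \<le> N * (norm (lam R t k) + norm (mu R t k))"
    unfolding N_def using d by (rule norm_multiplier_combination_le)
  ultimately show ?thesis
    unfolding N_def[symmetric] using c norm_triangle_ineq[of c] by (smt (verit) mult.assoc)
qed

lemma beta_bound:
  assumes "1 \<le> k" "t \<in> {2..T}"
  shows "norm (cut_beta P R t k) \<le> L_const P R K \<epsilon>b t"
proof (cases "stype P t")
  case S1
  then show ?thesis
    using grad_cost_bound[OF assms] assms by (simp add: cut_beta_def L_const_def)
next
  case S2
  then show ?thesis
    using slope_bound[OF assms S2 grad_cost_bound(2)[OF assms] grad_ineq_bound(2)[OF assms S2], of "matB P t"] assms
    by (simp add: cut_beta_def L_const_def del: transpose_matrix_vector)
qed

lemma q_lipschitz_L_const:
  assumes "1 \<le> k" "2 \<le> t"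
  shows "q t k u - q t k v \<le> L_const P R K \<epsilon>b t * norm (u - v)"
proof (cases "t \<le> T")
  case True
  then show ?thesis
    using assms beta_bound by (intro q_lipschitz) auto
qed (simp add: q_after_horizon L_const_def)

lemma eta_bound:
  assumes "1 \<le> k" "t \<in> {2..T}"
  shows "cut_eta P R t k \<le> eta_bar P R K \<epsilon>b t"
  unfolding cut_eta_def q_def[symmetric]
proof (rule cSUP_least)
  have tT: "t \<le> T" using assms by simp
  show "X t \<noteq> {}"
    using X_props[OF tT] by simp
  fix y assume y: "y \<in> X t"
  define D where "D = diameter (X t)"
  define S where "S = norm (decision_slope P R t k)"
  have diam: "norm (xB t k - y) \<le> D"
    unfolding D_def dist_norm[symmetric]
    by (intro diameter_bounded_bound compact_imp_bounded X_props tT trial_in(1)[OF assms] y)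
  then have D: "0 \<le> D"
    using norm_ge_zero order_trans by blast
  have L: "0 \<le> L_const P R K \<epsilon>b (Suc t)"
  proof (cases "Suc t \<le> T")
    case True
    then have "norm (cut_beta P R (Suc t) 1) \<le> L_const P R K \<epsilon>b (Suc t)"
      using assms by (intro beta_bound) auto
    then show ?thesis
      by (rule order_trans[OF norm_ge_zero])
  qed (simp add: L_const_def)
  have "decision_slope P R t k \<bullet> (xB t k - y) \<le> S * norm (xB t k - y)"
    unfolding S_def by (rule norm_cauchy_schwarz)
  also have "\<dots> \<le> S * D"
    using diam by (intro mult_left_mono) (auto simp: S_def)
  finally have 1: "decision_slope P R t k \<bullet> (xB t k - y) \<le> S * D" .
  have "q (Suc t) k (xB t k) - q (Suc t) k y \<le> L_const P R K \<epsilon>b (Suc t) * norm (xB t k - y)"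
    using assms by (intro q_lipschitz_L_const) auto
  also have "\<dots> \<le> L_const P R K \<epsilon>b (Suc t) * D"
    using diam L by (rule mult_left_mono)
  finally have 2: "q (Suc t) k (xB t k) - q (Suc t) k y \<le> L_const P R K \<epsilon>b (Suc t) * D" .
  have "(S + L_const P R K \<epsilon>b (Suc t)) * D \<le> eta_bar P R K \<epsilon>b t"
  proof (cases "stype P t")
    case S1
    then show ?thesis
      using grad_cost_bound[OF assms] D
      by (auto simp: S_def decision_slope_def eta_bar_def D_def intro!: mult_right_mono)
  next
    case S2
    have "S \<le> M2 K t + sqrt 2 * max (onorm ((*v) (transpose (matA P t)))) (M3 K t * sqrt (real CARD('p)))
           * U_const P R K \<epsilon>b t"
      using slope_bound[OF assms S2 grad_cost_bound(1)[OF assms] grad_ineq_bound(1)[OF assms S2], of "matA P t"] S2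
      by (simp add: S_def decision_slope_def del: transpose_matrix_vector)
    then show ?thesis
      using S2 D by (simp add: eta_bar_def D_def[symmetric] mult_right_mono del: transpose_matrix_vector)
  qed
  then show "decision_slope P R t k \<bullet> (xB t k - y) + q (Suc t) k (xB t k) - q (Suc t) k y \<le> eta_bar P R K \<epsilon>b t"
    using 1 2 by (simp add: distrib_right)
qed

text \<open>By duality \<open>cut_theta\<close> falls short of the stage minimum by at most the dual noise, and the cut
  lies \<open>cut_eta\<close> below \<open>cut_theta\<close> at the trial state.\<close>

lemma cut_gap:
  assumes "1 \<le> k" "t \<in> {2..T}"
  shows "low t k (x (t - 1) k) - cutfun R t k (x (t - 1) k) \<le> delta_bar P R K \<epsilon>b t"
proof -
  have "low t k (x (t - 1) k) \<le> cut_theta P R t k + (case stype P t of S1 \<Rightarrow> 0 | S2 \<Rightarrow> \<epsilon> t k)"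
    using low_le_lagrangian[OF assms trial_in(1)[OF assms]] theta_eq[OF assms] by simp
  moreover have "cutfun R t k (x (t - 1) k) = cut_theta P R t k - cut_eta P R t k"
    using cutfun_eq[OF assms] by simp
  ultimately show ?thesis
    using eta_bound[OF assms] noise[of t k] assms
    by (auto simp: delta_bar_def split: stage_type.splits)
qed

lemma delta_bar_nonneg:
  assumes "t \<in> {2..T}"
  shows "0 \<le> delta_bar P R K \<epsilon>b t"
proof -
  have "0 \<le> cut_eta P R t 1"
    using eta_upper[of 1 t "xB t 1"] trial_in(1)[of 1 t] assms by simp
  then have "0 \<le> eta_bar P R K \<epsilon>b t"
    using eta_bound[OF _ assms, of 1] by simp
  then show ?thesis
    using noise[of t 1] assms by (auto simp: delta_bar_def split: stage_type.splits)
qed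

lemma delta_bar_le_max:
  assumes "t \<in> {2..T}"
  shows "delta_bar P R K \<epsilon>b t \<le> delta_max P R K \<epsilon>b"
  using assms by (auto simp: delta_max_def intro: Max_ge)

lemma delta_max_nonneg: "0 \<le> delta_max P R K \<epsilon>b"
proof (cases "T = 1")
  case False
  then have "T \<in> {2..T}"
    using horizon_pos by simp
  then show ?thesis
    using delta_bar_nonneg delta_bar_le_max order_trans by blast
qed (simp add: delta_max_def delta_bar_def)

definition noise_max :: real where
  "noise_max = (MAX t\<in>{1..T}. \<epsilon>b t)"

lemma noise_le_max:
  assumes "t \<in> {1..T}" "1 \<le> k"
  shows "\<epsilon> t k \<le> noise_max"
proof -
  have "\<epsilon>b t \<le> noise_max"
    unfolding noise_max_def using assms by (intro Max_ge) auto
  then show ?thesis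
    using noise[OF assms] by simp
qed

lemma noise_max_nonneg: "0 \<le> noise_max"
  using noise[of 1 1] noise_le_max[of 1 1] horizon_pos by simp

section \<open>Accumulation points\<close>

text \<open>The next two lemmas are the two halves of the recursion for the run: forward near-optimality
  passes from stage \<open>t + 1\<close> at iteration \<open>k - 1\<close> to the minimum at stage \<open>t\<close>, and the cut gap passes
  from that minimum to \<open>\<Q>\<^sub>t\<^sup>k\<close>.\<close>

lemma forward_step:
  assumes "t \<in> {1..T}" "2 \<le> k"
  shows "f t (x t k, x (t - 1) k) + q (Suc t) (k - 1) (x t k) \<le> low t (k - 1) (x (t - 1) k) + noise_max"
proof -
  have k: "1 \<le> k" "1 \<le> k - 1" using assms by auto
  have u: "x (t - 1) k \<in> X (t - 1)"
    using fwd_in[OF k(1), of "t - 1"] assms by auto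
  have "eps_min (\<epsilon> t k) (\<lambda>y. stage_obj P R t (k - 1) y (x (t - 1) k)) (feas P t (x (t - 1) k)) (x t k)"
    using run assms(1) k(1) unfolding iddp_run_def by blast
  then have "stage_obj P R t (k - 1) (x t k) (x (t - 1) k) \<le> underval P R t (k - 1) (x (t - 1) k) + ereal (\<epsilon> t k)"
    by (simp add: eps_min_def underval_def)
  then have "f t (x t k, x (t - 1) k) + q (Suc t) (k - 1) (x t k) \<le> low t (k - 1) (x (t - 1) k) + \<epsilon> t k"
    unfolding stage_obj_eq[OF k(2)] underval_eq_low[OF assms(1) k(2) u] by simp
  then show ?thesis
    using noise_le_max[OF assms(1) k(1)] by simp
qed

lemma low_le_q:
  assumes "t \<in> {2..T}" "2 \<le> k"
  shows "low t (k - 1) (x (t - 1) k) \<le> q t k (x (t - 1) k) + delta_max P R K \<epsilon>b"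
proof -
  have k: "1 \<le> k" using assms by simp
  have "low t (k - 1) (x (t - 1) k) \<le> low t k (x (t - 1) k)"
    using assms trial_in(2)[OF k assms(1)] by (intro low_mono) auto
  moreover have "cutfun R t k (x (t - 1) k) \<le> q t k (x (t - 1) k)"
    using assms by (intro cut_le_q) auto
  ultimately show ?thesis
    using cut_gap[OF k assms(1)] delta_bar_le_max[OF assms(1)] by simp
qed

context
  fixes s :: "nat \<Rightarrow> nat" and z :: "nat \<Rightarrow> real^'n"
  assumes s: "strict_mono s"
    and lim: "\<And>t. t \<in> {1..T} \<Longrightarrow> (\<lambda>j. x t (s j)) \<longlonglongrightarrow> z t"
begin

abbreviation zz :: "nat \<Rightarrow> real^'n" where "zz \<equiv> with_init P z"

lemma s_pos: "1 \<le> j \<Longrightarrow> 1 \<le> s j"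
  using strict_mono_imp_increasing[OF s, of j] by simp

lemma fwd_tendsto:
  assumes "t \<le> T"
  shows "(\<lambda>j. x t (s j)) \<longlonglongrightarrow> zz t"
proof (cases "t = 0")
  case True
  have "\<forall>\<^sub>F j in sequentially. x 0 (s j) = x_init P"
    using eventually_ge_at_top[of 1] by eventually_elim (intro fwd_0 s_pos)
  then show ?thesis
    using True by (simp add: with_init_def tendsto_eventually)
next
  case False
  then show ?thesis
    using lim[of t] assms by (simp add: with_init_def)
qed

lemma limit_in:
  assumes "t \<le> T"
  shows "zz t \<in> X t"
proof (rule Lim_in_closed_set)
  show "closed (X t)"
    using X_props[OF assms] compact_imp_closed by blast
  show "\<forall>\<^sub>F j in sequentially. x t (s j) \<in> X t"
    using eventually_ge_at_top[of 1] by eventually_elim (intro fwd_in s_pos assms)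
qed (auto intro: fwd_tendsto assms)

lemma pair_tendsto:
  assumes "t \<in> {1..T}" "F differentiable (at (zz t, zz (t - 1)))"
  shows "(\<lambda>j. F (x t (s j), x (t - 1) (s j))) \<longlonglongrightarrow> F (zz t, zz (t - 1))"
proof -
  have "isCont F (zz t, zz (t - 1))"
    using assms(2) differentiable_imp_continuous_within by blast
  moreover have "(\<lambda>j. (x t (s j), x (t - 1) (s j))) \<longlonglongrightarrow> (zz t, zz (t - 1))"
    using assms(1) by (intro tendsto_Pair fwd_tendsto) auto
  ultimately show ?thesis
    by (rule isCont_tendsto_compose)
qed

lemma limit_pair_in: "t \<in> {1..T} \<Longrightarrow> (zz t, zz (t - 1)) \<in> X t \<times> X (t - 1)"
  using limit_in by auto

lemma limit_feasible: "feasible_traj P z"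
  unfolding feasible_traj_def
proof
  fix t assume t: "t \<in> {1..T}"
  have ev: "\<forall>\<^sub>F j in sequentially. x t (s j) \<in> feas P t (x (t - 1) (s j))"
    using eventually_ge_at_top[of 1] by eventually_elim (intro fwd_feas s_pos t)
  show "zz t \<in> feas P t (zz (t - 1))"
  proof (cases "stype P t")
    case S1
    then show ?thesis
      using limit_in t by (simp add: feas_def)
  next
    case S2
    have "ineq P t (zz t, zz (t - 1)) $ i \<le> 0" for i
    proof (rule tendsto_upperbound)
      show "(\<lambda>j. ineq P t (x t (s j), x (t - 1) (s j)) $ i) \<longlonglongrightarrow> ineq P t (zz t, zz (t - 1)) $ i"
        by (rule pair_tendsto[OF t ineq_props(2)[OF t S2 limit_pair_in[OF t]]])
      show "\<forall>\<^sub>F j in sequentially. ineq P t (x t (s j), x (t - 1) (s j)) $ i \<le> 0"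
        by (rule eventually_mono[OF ev]) (simp add: feas_def S2)
    qed simp
    moreover have "eq_resid P t (zz t) (zz (t - 1)) = 0"
    proof (rule LIMSEQ_unique)
      show "(\<lambda>j. eq_resid P t (x t (s j)) (x (t - 1) (s j))) \<longlonglongrightarrow> eq_resid P t (zz t) (zz (t - 1))"
        unfolding eq_resid_def using t
        by (intro tendsto_intros fwd_tendsto
            bounded_linear.tendsto[OF matrix_vector_mul_bounded_linear]) auto
      show "(\<lambda>j. eq_resid P t (x t (s j)) (x (t - 1) (s j))) \<longlonglongrightarrow> 0"
        by (rule tendsto_eventually, rule eventually_mono[OF ev]) (simp add: feas_def S2)
    qed
    ultimately show ?thesis
      using S2 limit_in t by (simp add: feas_def)
  qed
qed

text \<open>The forward step uses \<open>\<Q>\<^sub>t\<^sub>+\<^sub>1\<^sup>k\<^sup>-\<^sup>1\<close> at \<open>x\<^sub>t\<^sup>k\<close>. Along the subsequence this is at least the approximation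
  of the previous selected iteration, by monotonicity in \<open>k\<close>, and moving the argument to the previous
  selected point costs a Lipschitz term that vanishes in the limit because the points converge.\<close>

lemma lower_bound_step:
  assumes t: "t \<in> {1..T}" and w: "w \<longlonglongrightarrow> c"
    and ev: "\<forall>\<^sub>F j in sequentially. w j \<le> q (Suc t) (s j) (x t (s j))"
  shows "\<exists>w'. w' \<longlonglongrightarrow> f t (zz t, zz (t - 1)) + c - noise_max \<and>
    (\<forall>\<^sub>F j in sequentially. 2 \<le> s j \<and> w' j \<le> low t (s j - 1) (x (t - 1) (s j)))"
proof -
  define L where "L = L_const P R K \<epsilon>b (Suc t)"
  define w' where "w' = (\<lambda>j. f t (x t (s j), x (t - 1) (s j)) + w (j - 1)
    - L * norm (x t (s (j - 1)) - x t (s j)) - noise_max)"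
  have pred: "filterlim (\<lambda>j. j - 1) sequentially (sequentially :: nat filter)"
    by (rule filterlim_minus_const_nat_at_top)
  have "t \<le> T" using t by simp
  have "(\<lambda>j. x t (s (j - 1))) \<longlonglongrightarrow> zz t"
    by (rule filterlim_compose[OF fwd_tendsto[OF \<open>t \<le> T\<close>] pred])
  then have "(\<lambda>j. L * norm (x t (s (j - 1)) - x t (s j))) \<longlonglongrightarrow> L * norm (zz t - zz t)"
    by (intro tendsto_intros fwd_tendsto \<open>t \<le> T\<close>)
  moreover have "(\<lambda>j. f t (x t (s j), x (t - 1) (s j))) \<longlonglongrightarrow> f t (zz t, zz (t - 1))"
    using pair_tendsto[OF t cost_props(2)[OF t limit_pair_in[OF t]]] .
  moreover have "(\<lambda>j. w (j - 1)) \<longlonglongrightarrow> c"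
    by (rule filterlim_compose[OF w pred])
  ultimately have "w' \<longlonglongrightarrow> f t (zz t, zz (t - 1)) + c - L * norm (zz t - zz t) - noise_max"
    unfolding w'_def by (intro tendsto_diff tendsto_add tendsto_const)
  moreover have "\<forall>\<^sub>F j in sequentially. w (j - 1) \<le> q (Suc t) (s (j - 1)) (x t (s (j - 1)))"
    using eventually_compose_filterlim[OF ev pred] .
  then have "\<forall>\<^sub>F j in sequentially. 2 \<le> s j \<and> w' j \<le> low t (s j - 1) (x (t - 1) (s j))"
    using eventually_ge_at_top[of 2]
  proof eventually_elim
    case (elim j)
    have "s (j - 1) < s j"
      using elim by (intro strict_monoD[OF s]) auto
    moreover have pos: "1 \<le> s (j - 1)"
      using elim by (intro s_pos) auto
    ultimately have sj: "2 \<le> s j" "s (j - 1) \<le> s j - 1"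
      by auto
    have "q (Suc t) (s (j - 1)) (x t (s (j - 1))) - q (Suc t) (s (j - 1)) (x t (s j))
        \<le> L * norm (x t (s (j - 1)) - x t (s j))"
      unfolding L_def using pos t by (intro q_lipschitz_L_const) auto
    moreover have "q (Suc t) (s (j - 1)) (x t (s j)) \<le> q (Suc t) (s j - 1) (x t (s j))"
      using pos sj(2) by (rule q_mono)
    ultimately show ?case
      using elim forward_step[OF t sj(1)] sj(1) by (simp add: w'_def)
  qed
  ultimately show ?thesis
    by auto
qed

lemma q_lower_bound:
  assumes "2 \<le> t" "t \<le> Suc T"
  shows "\<exists>w. w \<longlonglongrightarrow> (\<Sum>i=t..T. f i (zz i, zz (i - 1)))
        - real (Suc T - t) * (noise_max + delta_max P R K \<epsilon>b) \<and>
      (\<forall>\<^sub>F j in sequentially. w j \<le> q t (s j) (x (t - 1) (s j)))"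
  using assms(2)
proof (induction rule: inc_induct)
  case base
  then show ?case
    by (intro exI[of _ "\<lambda>_. 0"]) (simp add: q_after_horizon)
next
  case (step t)
  then have t: "t \<in> {1..T}" "t \<in> {2..T}" using assms by auto
  define c where "c = (\<Sum>i=Suc t..T. f i (zz i, zz (i - 1)))
    - real (Suc T - Suc t) * (noise_max + delta_max P R K \<epsilon>b)"
  obtain w where w: "w \<longlonglongrightarrow> c" "\<forall>\<^sub>F j in sequentially. w j \<le> q (Suc t) (s j) (x t (s j))"
    using step.IH by (auto simp: c_def)
  obtain w' where w': "w' \<longlonglongrightarrow> f t (zz t, zz (t - 1)) + c - noise_max"
      "\<forall>\<^sub>F j in sequentially. 2 \<le> s j \<and> w' j \<le> low t (s j - 1) (x (t - 1) (s j))"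
    using lower_bound_step[OF t(1) w] by blast
  have "(\<lambda>j. w' j - delta_max P R K \<epsilon>b) \<longlonglongrightarrow> f t (zz t, zz (t - 1)) + c - noise_max - delta_max P R K \<epsilon>b"
    by (intro tendsto_intros w'(1))
  moreover have "real (Suc T - t) = real (Suc T - Suc t) + 1"
    using t by (simp add: of_nat_diff)
  then have "f t (zz t, zz (t - 1)) + c - noise_max - delta_max P R K \<epsilon>b
      = (\<Sum>i=t..T. f i (zz i, zz (i - 1))) - real (Suc T - t) * (noise_max + delta_max P R K \<epsilon>b)"
    using t sum.atLeast_Suc_atMost[of t T "\<lambda>i. f i (zz i, zz (i - 1))"] by (simp add: c_def algebra_simps)
  moreover have "\<forall>\<^sub>F j in sequentially. w' j - delta_max P R K \<epsilon>b \<le> q t (s j) (x (t - 1) (s j))"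
    using w'(2)
  proof eventually_elim
    case (elim j)
    then show ?case
      using low_le_q[OF t(2), of "s j"] by simp
  qed
  ultimately show ?case
    by auto
qed

text \<open>The bounds telescope: each stage contributes its noise, and each stage but the first a cut gap.\<close>

lemma limit_cost_le:
  "total_cost P z \<le> V 1 (x_init P) + real T * (noise_max + delta_max P R K \<epsilon>b)"
proof -
  have t: "1 \<in> {1..T}"
    using horizon_pos by simp
  define c where "c = (\<Sum>i=2..T. f i (zz i, zz (i - 1)))
    - real (T - 1) * (noise_max + delta_max P R K \<epsilon>b)"
  obtain w where w: "w \<longlonglongrightarrow> c" "\<forall>\<^sub>F j in sequentially. w j \<le> q (Suc 1) (s j) (x 1 (s j))"
    using q_lower_bound[of 2] horizon_pos by (auto simp: c_def numeral_2_eq_2)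
  obtain w' where w': "w' \<longlonglongrightarrow> f 1 (zz 1, zz (1 - 1)) + c - noise_max"
      "\<forall>\<^sub>F j in sequentially. 2 \<le> s j \<and> w' j \<le> low 1 (s j - 1) (x (1 - 1) (s j))"
    using lower_bound_step[OF t w] by blast
  have "\<forall>\<^sub>F j in sequentially. w' j \<le> V 1 (x_init P)"
    using w'(2)
  proof eventually_elim
    case (elim j)
    then have "1 \<le> s j" "1 \<le> s j - 1"
      by auto
    then show ?case
      using elim low_le_V[OF t, of "s j - 1" "x_init P"] fwd_0[of "s j"] by (simp add: XX_def)
  qed
  then have "f 1 (zz 1, zz 0) + c - noise_max \<le> V 1 (x_init P)"
    using tendsto_upperbound[OF w'(1)] by simp
  moreover have "total_cost P z = f 1 (zz 1, zz 0) + (\<Sum>i=2..T. f i (zz i, zz (i - 1)))"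
    unfolding total_cost_def numeral_2_eq_2 
    using sum.atLeast_Suc_atMost[OF horizon_pos, of "\<lambda>t. f t (zz t, zz (t - 1))"] by simp
  moreover have "real T * (noise_max + delta_max P R K \<epsilon>b)
      = real (T - 1) * (noise_max + delta_max P R K \<epsilon>b) + (noise_max + delta_max P R K \<epsilon>b)"
    using horizon_pos by (simp add: of_nat_diff left_diff_distrib)
  ultimately show ?thesis
    using delta_max_nonneg unfolding c_def by linarith
qed

lemma limit_eps_optimal:
  "eps_optimal_traj P (real T * (real T + 1) / 2 * (delta_max P R K \<epsilon>b + noise_max)) z"
proof -
  have "real T * 1 \<le> real T * ((real T + 1) / 2)"
    using horizon_pos by (intro mult_left_mono) auto
  then have "real T * (noise_max + delta_max P R K \<epsilon>b)
      \<le> real T * (real T + 1) / 2 * (noise_max + delta_max P R K \<epsilon>b)"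
    using delta_max_nonneg noise_max_nonneg by (intro mult_right_mono) auto
  then have "total_cost P z \<le> V 1 (x_init P) + real T * (real T + 1) / 2 * (delta_max P R K \<epsilon>b + noise_max)"
    using limit_cost_le by (simp add: add.commute)
  moreover have "valfun P 1 (x_init P) = ereal (V 1 (x_init P))"
    by (rule valfun_eq_V) (auto simp: XX_def)
  ultimately show ?thesis
    using limit_feasible by (simp add: eps_optimal_traj_def)
qed

end

end

theorem corollary4p8:
  fixes P :: "('n::finite, 'p::finite, 'q::finite) problem"
    and R :: "('n, 'p, 'q) execution"
    and K :: bounds
    and \<epsilon> :: "nat \<Rightarrow> nat \<Rightarrow> real"
    and \<epsilon>b :: "nat \<Rightarrow> real"
  assumes "1 \<le> horizon P"
    and "H1 P"
    and "H2 P (kap K) (rad K)"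
    and "valid_bounds P K"
    and "\<forall>t\<in>{1..horizon P}. \<forall>k\<ge>1. 0 \<le> \<epsilon> t k \<and> \<epsilon> t k \<le> \<epsilon>b t"
    and "iddp_run P \<epsilon> R"
  shows "(\<forall>t\<in>{2..horizon P}. \<forall>k\<ge>1.
            underval P R t k (fwd R (t - 1) k) - ereal (cutfun R t k (fwd R (t - 1) k))
              \<le> ereal (delta_bar P R K \<epsilon>b t) \<and>
            delta_bar P R K \<epsilon>b t \<le> delta_max P R K \<epsilon>b) \<and>
         (\<forall>z. accumulation_traj (horizon P) (fwd R) z \<longrightarrow>
            eps_optimal_traj P
              (real (horizon P) * (real (horizon P) + 1) / 2 *
                (delta_max P R K \<epsilon>b + (MAX t\<in>{1..horizon P}. \<epsilon>b t))) z)"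
proof -
  interpret noisy_iddp_run P R K \<epsilon> \<epsilon>b
    using assms by unfold_locales auto
  show ?thesis
  proof (intro conjI ballI allI impI)
    fix t k :: nat assume t: "t \<in> {2..horizon P}" and k: "1 \<le> k"
    have "t \<in> {1..horizon P}" using t by simp
    then show "underval P R t k (fwd R (t - 1) k) - ereal (cutfun R t k (fwd R (t - 1) k))
        \<le> ereal (delta_bar P R K \<epsilon>b t)"
      using cut_gap[OF k t] underval_eq_low[OF _ k trial_in(2)[OF k t]] by simp
    show "delta_bar P R K \<epsilon>b t \<le> delta_max P R K \<epsilon>b"
      by (rule delta_bar_le_max[OF t])
  next
    fix z assume "accumulation_traj (horizon P) (fwd R) z"
    then show "eps_optimal_traj P (real (horizon P) * (real (horizon P) + 1) / 2 *
        (delta_max P R K \<epsilon>b + (MAX t\<in>{1..horizon P}. \<epsilon>b t))) z"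
      unfolding accumulation_traj_def using limit_eps_optimal unfolding noise_max_def by blast
  qed
qed

end
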